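(* Let $w:\mathbb R^d\to[0,\infty)$ be a weight function, and let $\Omega$ and $\Omega'$ be two quadrature domains for $w$. Then $\Omega$ and $\Omega'$ are essentially equal, i.e. $\lambda\big((\Omega\setminus\Omega')\cup(\Omega'\setminus\Omega)\big)=0$.
   Context: $\lambda$ is Lebesgue measure on $\mathbb R^d$. A weight function is a bounded, nonnegative, measurable function on $\mathbb R^d$. For $\Omega\subseteq\mathbb R^d$ open and $h:\Omega\to\mathbb R\cup\{\pm\infty\}$ locally integrable, let $A_h(x;r)=\frac1{\lambda(B_r(x))}\int_{B_r(x)}h(y)\,dy$ be the average of $h$ over the open ball $B_r(x)$. Such an $h$ is subharmonic at $x\in\Omega$ if (a) $\limsup_{y\to x}h(y)\le h(x)$, and (b) $h(x)\le A_h(x;r)$ for all sufficiently small $r>0$. It is subharmonic on $\Omega$ if it is subharmonic at every point of $\Omega$. A quadrature domain for a weight function $w$ is a bounded open set $\Omega\subseteq\mathbb R^d$ such that $w\equiv0$ outside $\Omega$ and $\int hw\,dx\le\int_\Omega h\,dx$ for every integrable subharmonic function $h$ on $\Omega$ (the left integral is over $\Omega$, since $w$ vanishes outside $\Omega$). *)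

theory Defs
  imports "HOL-Analysis.Analysis"
begin

definition ereal_integrable_on :: "('a::euclidean_space \<Rightarrow> ereal) \<Rightarrow> 'a set \<Rightarrow> bool"
    (infix \<open>ereal'_integrable'_on\<close> 46) where
  "h ereal_integrable_on S \<longleftrightarrow>
     h \<in> borel_measurable (lebesgue_on S) \<and> (\<integral>\<^sup>+ x. e2ennreal \<bar>h x\<bar> \<partial>lebesgue_on S) < \<infinity>"

(* Used only for integrable h.  Such an h is finite almost everywhere, so that the convention
   real_of_ereal (\<plusminus>\<infinity>) = 0 changes h on a null set only. *)
definition ereal_integral :: "'a::euclidean_space set \<Rightarrow> ('a \<Rightarrow> ereal) \<Rightarrow> real" where
  "ereal_integral S h = (\<integral> x. real_of_ereal (h x) \<partial>lebesgue_on S)"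

definition ereal_locally_integrable_on :: "('a::euclidean_space \<Rightarrow> ereal) \<Rightarrow> 'a set \<Rightarrow> bool"
    (infix \<open>ereal'_locally'_integrable'_on\<close> 46) where
  "h ereal_locally_integrable_on \<Omega> \<longleftrightarrow> (\<forall>K. compact K \<and> K \<subseteq> \<Omega> \<longrightarrow> h ereal_integrable_on K)"

definition ball_average :: "('a::euclidean_space \<Rightarrow> ereal) \<Rightarrow> 'a \<Rightarrow> real \<Rightarrow> real" where
  "ball_average h x r = ereal_integral (ball x r) h / measure lebesgue (ball x r)"

(* A function on an open set \<Omega> is represented by a total function; only its values on \<Omega>
   matter, since the balls of all sufficiently small radii around x \<in> \<Omega> lie in \<Omega>. *)
definition subharmonic_at :: "'a::euclidean_space set \<Rightarrow> ('a \<Rightarrow> ereal) \<Rightarrow> 'a \<Rightarrow> bool" where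
  "subharmonic_at \<Omega> h x \<longleftrightarrow>
     Limsup (at x within \<Omega>) h \<le> h x \<and>
     (\<forall>\<^sub>F r in at_right 0. h x \<le> ereal (ball_average h x r))"

definition subharmonic_on :: "'a::euclidean_space set \<Rightarrow> ('a \<Rightarrow> ereal) \<Rightarrow> bool" where
  "subharmonic_on \<Omega> h \<longleftrightarrow>
     open \<Omega> \<and> h ereal_locally_integrable_on \<Omega> \<and> (\<forall>x\<in>\<Omega>. subharmonic_at \<Omega> h x)"

definition weight_function :: "('a::euclidean_space \<Rightarrow> real) \<Rightarrow> bool" where
  "weight_function w \<longleftrightarrow>
     bounded (range w) \<and> (\<forall>x. 0 \<le> w x) \<and> w \<in> borel_measurable lebesgue"

definition quadrature_domain :: "('a::euclidean_space \<Rightarrow> real) \<Rightarrow> 'a set \<Rightarrow> bool" where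
  "quadrature_domain w \<Omega> \<longleftrightarrow>
     bounded \<Omega> \<and> open \<Omega> \<and> (\<forall>x. x \<notin> \<Omega> \<longrightarrow> w x = 0) \<and>
     (\<forall>h. h ereal_integrable_on \<Omega> \<and> subharmonic_on \<Omega> h \<longrightarrow>
        ereal_integral \<Omega> (\<lambda>x. h x * ereal (w x)) \<le> ereal_integral \<Omega> h)"

end

theory Submission
  imports Defs
begin

text \<open>Let \<open>k\<close> be the fundamental solution of the Laplacian on \<open>\<real>\<^sup>d\<close> with the sign that makes it subharmonic
(a multiple of \<open>\<bar>x\<bar>\<close>, \<open>ln \<bar>x\<bar>\<close> or \<open>- \<bar>x\<bar>\<^bsup>2-d\<^esup>\<close>), and for a set \<open>S\<close> put \<open>V\<^sub>S(y) = \<integral>\<^sub>S k(x - y) dx\<close>.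

Two families of test functions carry the whole argument. For every \<open>y\<close> the function \<open>k(\<sqdot> - y)\<close> is subharmonic,
so the potential of the weight satisfies \<open>V\<^sub>w \<le> V\<^sub>\<Omega>'\<close> everywhere. For \<open>y \<notin> \<Omega>\<close> the function \<open>-k(\<sqdot> - y)\<close> is
harmonic on \<open>\<Omega>\<close>, so \<open>V\<^sub>\<Omega>(y) \<le> V\<^sub>w(y)\<close>. Hence \<open>v = V\<^sub>\<Omega> - V\<^sub>\<Omega>'\<close> is nonpositive outside \<open>\<Omega>\<close>
(lemma \<open>quadrature_potential_le\<close>). Inside \<open>\<Omega>\<close> the distributional Laplacian of \<open>v\<close> is a positive multiple of
\<open>1\<^sub>\<Omega> - 1\<^sub>\<Omega>' = 1\<^bsub>\<Omega>-\<Omega>'\<^esub> \<ge> 0\<close>, so \<open>v\<close> is subharmonic there and the maximum principle gives \<open>v \<le> 0\<close> everywhere.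
Exchanging the roles of the two domains, \<open>v = 0\<close>, and then its Laplacian vanishes on \<open>\<Omega>\<close>: the set \<open>\<Omega> - \<Omega>'\<close> is null.

Distributions are replaced by averages over balls. By the symmetry of the kernel,
\<open>\<integral>\<^sub>B v - \<lambda>(B) v(y)\<close> for a closed ball \<open>B \<subseteq> \<Omega>\<close> about \<open>y\<close> equals the integral over \<open>\<Omega> - \<Omega>'\<close> of the function
\<open>mean_excess\<close>, which is nonnegative by the mean value inequality for \<open>k\<close> and positive near \<open>y\<close>
(lemma \<open>potential_difference_mean_value\<close>). This one identity yields both the subharmonicity of \<open>v\<close> and, once \<open>v = 0\<close>,
that \<open>\<Omega> - \<Omega>'\<close> is locally null in \<open>\<Omega>\<close>.

The singularity of \<open>k\<close> is handled through the smooth subharmonic kernels obtained by replacing \<open>\<bar>x\<bar>\<^sup>2\<close> with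
\<open>\<bar>x\<bar>\<^sup>2 + e\<close> for \<open>e > 0\<close>: they decrease to \<open>k\<close> as \<open>e\<close> decreases to \<open>0\<close>. Their mean value inequality follows from
the divergence theorem for compactly supported Lipschitz fields, which needs only difference quotients and the translation
invariance of Lebesgue measure.\<close>

section \<open>Integration by parts and the mean value inequality\<close>

lemma lborel_integral_translate:
  fixes f :: "'a::euclidean_space \<Rightarrow> real"
  assumes [measurable]: "f \<in> borel_measurable borel"
  shows "(\<integral>x. f (x + c) \<partial>lborel) = (\<integral>x. f x \<partial>lborel)"
proof -
  have "(\<integral>x. f x \<partial>lborel) = (\<integral>x. f x \<partial>distr lborel borel ((+) c))"
    by (simp add: lborel_distr_plus)
  also have "\<dots> = (\<integral>x. f (x + c) \<partial>lborel)"
    by (subst integral_distr) (auto simp: add.commute)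
  finally show ?thesis ..
qed

lemma lborel_integrable_translate:
  fixes f :: "'a::euclidean_space \<Rightarrow> real"
  assumes "integrable lborel f"
  shows "integrable lborel (\<lambda>x. f (x + c))"
proof -
  have "integrable (distr lborel borel ((+) c)) f"
    using assms by (simp add: lborel_distr_plus)
  then show ?thesis by (subst (asm) integrable_distr_eq) (use assms in \<open>auto simp: add.commute\<close>)
qed

lemma AE_lborel_not_sphere: "AE x in lborel. x \<notin> sphere (a::'a::euclidean_space) r"
proof -
  have "sphere a r \<in> null_sets lebesgue"
    using negligible_sphere[of a r] by (simp add: negligible_iff_null_sets)
  then have "sphere a r \<in> null_sets lborel"
    by (simp add: null_sets_completion_iff)
  then show ?thesis by (rule AE_not_in)
qed

text \<open>The difference quotients of \<open>F\<close> in direction \<open>e\<close> integrate to zero by translation invariance, and the Lipschitz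
bound together with the bounded support dominates them. This is integration by parts without boundary terms, for functions
that may fail to be differentiable on a null set.\<close>
lemma integral_directional_derivative_eq_0:
  fixes F D :: "'a::euclidean_space \<Rightarrow> real"
  assumes lip: "\<And>p q. \<bar>F p - F q\<bar> \<le> L * norm (p - q)"
    and supp: "\<And>p. R \<le> norm p \<Longrightarrow> F p = 0"
    and der: "AE p in lborel. ((\<lambda>s. F (p + s *\<^sub>R e)) has_real_derivative D p) (at 0)"
    and [measurable]: "D \<in> borel_measurable borel"
  shows "integrable lborel D" and "(\<integral>p. D p \<partial>lborel) = 0"
proof -
  have "L-lipschitz_on UNIV F \<or> L < 0"
    using lip by (auto simp: lipschitz_on_def dist_norm)
  then have contF: "continuous_on UNIV F"
  proof
    assume "L-lipschitz_on UNIV F"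
    then show ?thesis by (rule lipschitz_on_continuous_on)
  next
    assume "L < 0"
    have "F p = F q" for p q
      using lip[of p q] mult_nonneg_nonneg[of "-L" "norm (p - q)"] \<open>L < 0\<close> by auto
    then have "F = (\<lambda>_. F 0)" by auto
    then show ?thesis by (metis continuous_on_const)
  qed
  have [measurable]: "F \<in> borel_measurable borel"
    using contF by (rule borel_measurable_continuous_onI)
  \<comment> \<open>difference quotients with step \<open>1 / (n + 1)\<close>, supported in the enlarged ball \<open>B\<close> because the step is at most 1\<close>
  define q where "q n p = (F (p + (1 / Suc n) *\<^sub>R e) - F p) * Suc n" for n p
  define B where "B = cball (0::'a) (R + norm e)"
  define w where "w p = indicator B p *\<^sub>R (L * norm e)" for p
  have [measurable]: "q n \<in> borel_measurable borel" for n
    unfolding q_def by measurable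
  have wint: "integrable lborel w"
    unfolding w_def B_def by (rule borel_integrable_compact) auto
  have bound: "norm (q n p) \<le> w p" for n p
  proof (cases "p \<in> B")
    case True
    have "\<bar>F (p + (1 / Suc n) *\<^sub>R e) - F p\<bar> \<le> L * norm ((1 / Suc n) *\<^sub>R e)"
      using lip[of "p + (1 / Suc n) *\<^sub>R e" p] by simp
    then have "\<bar>F (p + (1 / Suc n) *\<^sub>R e) - F p\<bar> * Suc n \<le> L * norm ((1 / Suc n) *\<^sub>R e) * Suc n"
      by (rule mult_right_mono) simp
    also have "\<dots> = L * norm e" by simp
    finally show ?thesis
      using True unfolding q_def w_def by (simp only: abs_mult real_norm_def) simp
  next
    case False
    then have n1: "norm p > R + norm e" by (simp add: B_def)
    have "norm ((1 / Suc n) *\<^sub>R e) \<le> norm e"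
      by (simp add: divide_le_eq algebra_simps)
    moreover have "norm p \<le> norm (p + (1 / Suc n) *\<^sub>R e) + norm ((1 / Suc n) *\<^sub>R e)"
      by (metis norm_triangle_ineq4 add_diff_cancel_right')
    ultimately have "R \<le> norm (p + (1 / Suc n) *\<^sub>R e)" "R \<le> norm p"
      using n1 norm_ge_zero[of e] by linarith+
    then show ?thesis using False supp by (simp add: q_def w_def)
  qed
  have lim: "AE p in lborel. (\<lambda>n. q n p) \<longlonglongrightarrow> D p"
    using der
  proof eventually_elim
    case (elim p)
    then have "((\<lambda>h. (F (p + h *\<^sub>R e) - F p) / h) \<longlongrightarrow> D p) (at 0)"
      by (simp add: DERIV_def)
    moreover have "filterlim (\<lambda>n. 1 / real (Suc n)) (at 0) sequentially"
      using LIMSEQ_inverse_real_of_nat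
      by (auto simp: filterlim_at inverse_eq_divide)
    ultimately have "(\<lambda>n. (F (p + (1 / Suc n) *\<^sub>R e) - F p) / (1 / Suc n)) \<longlonglongrightarrow> D p"
      by (rule filterlim_compose)
    then show ?case by (simp add: q_def)
  qed
  show "integrable lborel D"
    by (rule integrable_dominated_convergence[where s = q and w = w]) (use lim wint bound in auto)
  have "(\<lambda>n. \<integral>p. q n p \<partial>lborel) \<longlonglongrightarrow> (\<integral>p. D p \<partial>lborel)"
    by (rule integral_dominated_convergence[where w = w]) (use lim wint bound in auto)
  moreover have "(\<integral>p. q n p \<partial>lborel) = 0" for n
  proof -
    have i1: "integrable lborel F"
    proof -
      have "integrable lborel (\<lambda>p. indicator (cball 0 R) p *\<^sub>R F p)"
        using contF by (intro borel_integrable_compact) (auto intro: continuous_on_subset)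
      moreover have "(\<lambda>p. indicator (cball 0 R) p *\<^sub>R F p) = F"
        using supp by (auto simp: fun_eq_iff indicator_def)
      ultimately show ?thesis by simp
    qed
    have i2: "integrable lborel (\<lambda>p. F (p + c))" for c
      using i1 by (rule lborel_integrable_translate)
    show ?thesis
      unfolding q_def
      by (simp add: i1 i2 Bochner_Integration.integral_diff lborel_integral_translate)
  qed
  ultimately show "(\<integral>p. D p \<partial>lborel) = 0"
    by (simp add: LIMSEQ_const_iff)
qed

text \<open>The paraboloid \<open>r\<^sup>2 - y \<bullet> y\<close> vanishes on the sphere, so multiplying the field \<open>G\<close> by it and extending by zero
gives a compactly supported Lipschitz field; its divergence, whose integral vanishes, is
\<open>(r\<^sup>2 - y \<bullet> y) div G - 2 y \<bullet> G\<close> on the ball. The left-hand side below is the flux that governs how averages over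
balls change with the radius.\<close>
lemma integral_divergence_paraboloid:
  fixes G :: "'a::euclidean_space \<Rightarrow> 'a"
  assumes r: "r > 0"
    and lip: "L-lipschitz_on (cball 0 r) G"
    and dG: "\<And>y. y \<in> ball 0 r \<Longrightarrow> (G has_derivative G' y) (at y)"
    and cont: "\<And>b. b \<in> Basis \<Longrightarrow> continuous_on (cball 0 r) (\<lambda>y. G' y b \<bullet> b)"
  shows "2 * (LINT y:cball 0 r|lborel. y \<bullet> G y)
       = (LINT y:cball 0 r|lborel. (r\<^sup>2 - y \<bullet> y) * (\<Sum>b\<in>Basis. G' y b \<bullet> b))"
proof -
  have cG: "continuous_on (cball 0 r) G" using lip by (rule lipschitz_on_continuous_on)
  have L: "L \<ge> 0" using lip by (simp add: lipschitz_on_def)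
  obtain M where M: "\<And>y. y \<in> cball 0 r \<Longrightarrow> norm (G y) \<le> M"
    using compact_imp_bounded[OF compact_continuous_image[OF cG compact_cball]]
    by (force simp: bounded_iff)
  have M0: "M \<ge> 0" using M[of 0] r by (simp add: order_trans[OF norm_ge_zero])
  define B where "B = cball (0::'a) r"
  define f where "f b y = (r\<^sup>2 - y \<bullet> y) * (G y \<bullet> b)" for b y
  define F where "F b y = indicator B y * f b y" for b y
  define d where "d b y = (r\<^sup>2 - y \<bullet> y) * (G' y b \<bullet> b) - 2 * (y \<bullet> b) * (G y \<bullet> b)" for b y
  define D where "D b y = indicator B y *\<^sub>R d b y" for b y
  have *: "integrable lborel (D b) \<and> (\<integral>y. D b y \<partial>lborel) = 0" if b: "b \<in> Basis" for b
  proof -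
    have Mb: "\<bar>G y \<bullet> b\<bar> \<le> M" if "y \<in> cball 0 r" for y
      using M[OF that] Basis_le_norm[OF b, of "G y"] by simp
    have sq: "r\<^sup>2 - y \<bullet> y = (r - norm y) * (r + norm y)" for y :: 'a
      by (simp add: dot_square_norm power2_eq_square algebra_simps)
    have bd: "\<bar>f b p\<bar> \<le> 2 * r * M * (r - norm p)" if "p \<in> cball 0 r" for p
    proof -
      have "\<bar>f b p\<bar> = (r - norm p) * (r + norm p) * \<bar>G p \<bullet> b\<bar>"
        using that r by (simp add: f_def sq abs_mult)
      also have "\<dots> \<le> (r - norm p) * (2 * r) * M"
        using that r M0 Mb[OF that] by (intro mult_mono) auto
      finally show ?thesis by (simp add: mult_ac)
    qed
    define C where "C = 2 * r * M + r\<^sup>2 * L"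
    have C2: "2 * r * M \<le> C" using r L by (simp add: C_def)
    \<comment> \<open>across the sphere, the paraboloid already pays for the distance to the boundary\<close>
    have inout: "\<bar>F b p - F b q\<bar> \<le> C * norm (p - q)" if "p \<in> B" "q \<notin> B" for p q
    proof -
      have "\<bar>F b p - F b q\<bar> \<le> 2 * r * M * (r - norm p)"
        using that bd by (simp add: F_def B_def)
      also have "\<dots> \<le> C * norm (p - q)"
      proof (rule mult_mono)
        show "r - norm p \<le> norm (p - q)"
          using that norm_triangle_ineq2[of q p] by (simp add: B_def norm_minus_commute)
      qed (use that C2 r M0 L in \<open>auto simp: B_def C_def\<close>)
      finally show ?thesis .
    qed
    have inin: "\<bar>F b p - F b q\<bar> \<le> C * norm (p - q)" if "p \<in> B" "q \<in> B" for p q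
    proof -
      have "F b p - F b q = (r\<^sup>2 - p \<bullet> p) * ((G p - G q) \<bullet> b) + (q \<bullet> q - p \<bullet> p) * (G q \<bullet> b)"
        using that by (simp add: F_def f_def algebra_simps)
      also have "\<bar>\<dots>\<bar> \<le> r\<^sup>2 * (L * norm (p - q)) + norm (p - q) * (2 * r) * M"
      proof (rule order_trans[OF abs_triangle_ineq add_mono])
        have "\<bar>(G p - G q) \<bullet> b\<bar> \<le> norm (G p - G q)"
          using Basis_le_norm[OF b] .
        also have "\<dots> \<le> L * norm (p - q)"
          using lipschitz_onD[OF lip, of p q] that by (simp add: B_def dist_norm)
        finally have 1: "\<bar>(G p - G q) \<bullet> b\<bar> \<le> L * norm (p - q)" .
        have "p \<bullet> p \<le> r\<^sup>2" using that r by (simp add: B_def dot_square_norm)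
        then have 2: "\<bar>r\<^sup>2 - p \<bullet> p\<bar> \<le> r\<^sup>2" by simp
        show "\<bar>(r\<^sup>2 - p \<bullet> p) * ((G p - G q) \<bullet> b)\<bar> \<le> r\<^sup>2 * (L * norm (p - q))"
          unfolding abs_mult using 1 2 by (intro mult_mono) auto
        have "q \<bullet> q - p \<bullet> p = (norm q - norm p) * (norm q + norm p)"
          by (simp add: dot_square_norm power2_eq_square algebra_simps)
        moreover have "\<bar>norm q - norm p\<bar> \<le> norm (p - q)"
          by (metis norm_minus_commute norm_triangle_ineq3)
        ultimately have 3: "\<bar>q \<bullet> q - p \<bullet> p\<bar> \<le> norm (p - q) * (2 * r)"
          unfolding abs_mult using that
          by (simp only: abs_mult, intro mult_mono) (auto simp: B_def)
        show "\<bar>(q \<bullet> q - p \<bullet> p) * (G q \<bullet> b)\<bar> \<le> norm (p - q) * (2 * r) * M"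
          unfolding abs_mult using 3 Mb[of q] that r by (intro mult_mono) (auto simp: B_def)
      qed
      also have "\<dots> = C * norm (p - q)" by (simp add: C_def algebra_simps)
      finally show ?thesis .
    qed
    have lipF: "\<bar>F b p - F b q\<bar> \<le> C * norm (p - q)" for p q
    proof -
      consider "p \<in> B" "q \<in> B" | "p \<in> B" "q \<notin> B" | "p \<notin> B" "q \<in> B" | "p \<notin> B" "q \<notin> B"
        by blast
      then show ?thesis
      proof cases
        case 3
        then show ?thesis using inout[of q p] by (simp add: norm_minus_commute abs_minus_commute)
      next
        case 4
        then show ?thesis using C2 r M0 by (simp add: F_def order_trans[of 0 "2 * r * M" C])
      qed (use inin inout in auto)
    qed
    have suppF: "F b p = 0" if "r \<le> norm p" for p
      using that r by (auto simp: F_def f_def B_def dot_square_norm indicator_def)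
    have derF: "AE p in lborel. ((\<lambda>s. F b (p + s *\<^sub>R b)) has_real_derivative D b p) (at 0)"
      using AE_lborel_not_sphere[of 0 r]
    proof eventually_elim
      case (elim p)
      have line: "((\<lambda>s. p + s *\<^sub>R b) has_derivative (\<lambda>s. s *\<^sub>R b)) (at 0)"
        by (auto intro!: derivative_eq_intros)
      consider "p \<in> ball 0 r" | "p \<in> - cball 0 r" using elim by fastforce
      then show ?case
      proof cases
        case 1
        have "(f b has_derivative (\<lambda>h. (r\<^sup>2 - p \<bullet> p) * (G' p h \<bullet> b) - (2 * (p \<bullet> h)) * (G p \<bullet> b))) (at p)"
          unfolding f_def using dG[OF 1]
          by (auto intro!: derivative_eq_intros simp: inner_commute algebra_simps fun_eq_iff)
        then have "(F b has_derivative (\<lambda>h. (r\<^sup>2 - p \<bullet> p) * (G' p h \<bullet> b) - (2 * (p \<bullet> h)) * (G p \<bullet> b))) (at p)"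
          by (rule has_derivative_transform_within_open[of _ _ _ _ "ball 0 r"])
             (use 1 in \<open>auto simp: F_def B_def\<close>)
        then have "(F b has_derivative (\<lambda>h. (r\<^sup>2 - p \<bullet> p) * (G' p h \<bullet> b) - (2 * (p \<bullet> h)) * (G p \<bullet> b))) (at (p + 0 *\<^sub>R b))"
          by simp
        from has_derivative_compose[OF line this]
        have "((\<lambda>s. F b (p + s *\<^sub>R b)) has_derivative
            (\<lambda>s. (r\<^sup>2 - p \<bullet> p) * (G' p (s *\<^sub>R b) \<bullet> b) - 2 * (p \<bullet> (s *\<^sub>R b)) * (G p \<bullet> b))) (at 0)" .
        moreover have "G' p (s *\<^sub>R b) = s *\<^sub>R G' p b" for s
          using dG[OF 1] by (simp add: has_derivative_def bounded_linear.linear linear_scale)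
        then have "(\<lambda>s. (r\<^sup>2 - p \<bullet> p) * (G' p (s *\<^sub>R b) \<bullet> b) - 2 * (p \<bullet> (s *\<^sub>R b)) * (G p \<bullet> b)) = (*) (D b p)"
          using 1 by (simp add: D_def d_def B_def fun_eq_iff algebra_simps)
        ultimately show ?thesis
          by (simp add: has_field_derivative_def)
      next
        case 2
        have "(F b has_derivative (\<lambda>h. 0)) (at p)"
          by (rule has_derivative_transform_within_open[of "\<lambda>_. 0" _ _ _ "- cball 0 r"])
             (use 2 in \<open>auto simp: F_def B_def\<close>)
        then have "(F b has_derivative (\<lambda>h. 0)) (at (p + 0 *\<^sub>R b))"
          by simp
        from has_derivative_compose[OF line this]
        show ?thesis using 2 by (simp add: has_field_derivative_def D_def B_def lambda_zero[symmetric])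
      qed
    qed
    have cd: "continuous_on (cball 0 r) (d b)"
      unfolding d_def by (intro continuous_on_diff continuous_on_mult cont[OF b] cG continuous_intros)
    have mD: "D b \<in> borel_measurable borel"
      using borel_integrable_compact[OF compact_cball cd] by (simp add: D_def[abs_def] B_def borel_measurable_integrable)
    from integral_directional_derivative_eq_0[OF lipF suppF derF mD] show ?thesis by simp
  qed
  have sumd: "(\<Sum>b\<in>Basis. d b y) = (r\<^sup>2 - y \<bullet> y) * (\<Sum>b\<in>Basis. G' y b \<bullet> b) - 2 * (y \<bullet> G y)" for y
    unfolding d_def sum_subtractf euclidean_inner[of y "G y"]
    by (simp add: sum_distrib_left mult.assoc)
  have c1: "continuous_on (cball 0 r) (\<lambda>y. (r\<^sup>2 - y \<bullet> y) * (\<Sum>b\<in>Basis. G' y b \<bullet> b))"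
    by (intro continuous_on_mult continuous_on_diff continuous_on_sum cont continuous_intros)
  have c2: "continuous_on (cball 0 r) (\<lambda>y. 2 * (y \<bullet> G y))"
    using cG by (intro continuous_intros)
  have "0 = (\<Sum>b\<in>Basis. \<integral>y. D b y \<partial>lborel)"
    using * by simp
  also have "\<dots> = (\<integral>y. (\<Sum>b\<in>Basis. D b y) \<partial>lborel)"
    using * by (intro Bochner_Integration.integral_sum[symmetric]) auto
  also have "\<dots> = (LINT y:cball 0 r|lborel. (r\<^sup>2 - y \<bullet> y) * (\<Sum>b\<in>Basis. G' y b \<bullet> b) - 2 * (y \<bullet> G y))"
    unfolding set_lebesgue_integral_def D_def B_def sumd[symmetric] scaleR_sum_right ..
  also have "\<dots> = (LINT y:cball 0 r|lborel. (r\<^sup>2 - y \<bullet> y) * (\<Sum>b\<in>Basis. G' y b \<bullet> b))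
      - (LINT y:cball 0 r|lborel. 2 * (y \<bullet> G y))"
    by (rule set_integral_diff)
       (use borel_integrable_compact[OF compact_cball c1] borel_integrable_compact[OF compact_cball c2]
         in \<open>auto simp: set_integrable_def\<close>)
  finally show ?thesis by simp
qed

text \<open>Write \<open>f(x + y) - f(x)\<close> as the integral of \<open>y \<bullet> G(x + t y)\<close> over \<open>t \<in> [0, 1]\<close> and integrate over the ball of
radius \<open>r\<close> first. For fixed \<open>t\<close>, the paraboloid identity turns the integral over \<open>y\<close> into half the integral of
\<open>r\<^sup>2 - y \<bullet> y\<close> times the divergence of \<open>y \<mapsto> G(x + t y)\<close>, which is \<open>t\<close> times the Laplacian of \<open>f\<close> at
\<open>x + t y\<close> and therefore nonnegative.\<close>
lemma subharmonic_C2_mean_value: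
  fixes f :: "'a::euclidean_space \<Rightarrow> real" and G :: "'a \<Rightarrow> 'a"
  assumes r: "r > 0"
    and df: "\<And>z. z \<in> cball x r \<Longrightarrow> (f has_derivative (\<lambda>h. G z \<bullet> h)) (at z)"
    and dG: "\<And>z. z \<in> cball x r \<Longrightarrow> (G has_derivative G' z) (at z)"
    and lip: "L-lipschitz_on (cball x r) G"
    and cont: "\<And>b. b \<in> Basis \<Longrightarrow> continuous_on (cball x r) (\<lambda>z. G' z b \<bullet> b)"
    and sub: "\<And>z. z \<in> cball x r \<Longrightarrow> (\<Sum>b\<in>Basis. G' z b \<bullet> b) \<ge> 0"
  shows "measure lborel (cball x r) * f x \<le> (LINT z:cball x r|lborel. f z)"
proof -
  have cf: "continuous_on (cball x r) f"
    using df by (meson continuous_at_imp_continuous_on has_derivative_continuous)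
  have cG: "continuous_on (cball x r) G" using lip by (rule lipschitz_on_continuous_on)
  have inball: "x + t *\<^sub>R y \<in> cball x r" if "y \<in> cball 0 r" "0 \<le> t" "t \<le> 1" for t y
  proof -
    have "t * norm y \<le> 1 * r" using that by (intro mult_mono) auto
    then show ?thesis using that by (simp add: dist_norm)
  qed
  define H where "H t y = indicator {0..1} t * indicator (cball 0 r) y * (y \<bullet> G (x + t *\<^sub>R y))" for t :: real and y
  have inner_nonneg: "0 \<le> (\<integral>y. H t y \<partial>lborel)" for t
  proof (cases "t \<in> {0..1}")
    case True
    have tL: "L-lipschitz_on (cball 0 r) (\<lambda>y. G (x + t *\<^sub>R y))"
    proof (rule lipschitz_onI)
      show "L \<ge> 0" using lip by (simp add: lipschitz_on_def)
      fix y y' :: 'a assume y: "y \<in> cball 0 r" "y' \<in> cball 0 r"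
      have "dist (G (x + t *\<^sub>R y)) (G (x + t *\<^sub>R y')) \<le> L * dist (x + t *\<^sub>R y) (x + t *\<^sub>R y')"
        by (rule lipschitz_onD[OF lip]) (use inball y True in \<open>simp_all only: atLeastAtMost_iff\<close>)
      also have "dist (x + t *\<^sub>R y) (x + t *\<^sub>R y') = t * dist y y'"
        using True by (simp add: dist_norm flip: scaleR_diff_right)
      also have "L * (t * dist y y') \<le> L * (1 * dist y y')"
        using True \<open>L \<ge> 0\<close> by (intro mult_left_mono mult_right_mono) auto
      finally show "dist (G (x + t *\<^sub>R y)) (G (x + t *\<^sub>R y')) \<le> L * dist y y'" by simp
    qed
    have dt: "((\<lambda>y. G (x + t *\<^sub>R y)) has_derivative (\<lambda>h. G' (x + t *\<^sub>R y) (t *\<^sub>R h))) (at y)"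
      if "y \<in> cball 0 r" for y
    proof -
      have "((\<lambda>y. x + t *\<^sub>R y) has_derivative (\<lambda>h. t *\<^sub>R h)) (at y)"
        by (auto intro!: derivative_eq_intros)
      from has_derivative_compose[OF this dG[OF inball[OF that]]] True show ?thesis by simp
    qed
    have lin: "G' (x + t *\<^sub>R y) (t *\<^sub>R b) = t *\<^sub>R G' (x + t *\<^sub>R y) b" if "y \<in> cball 0 r" for y b
      using dG[OF inball[OF that]] True
      by (simp add: has_derivative_def bounded_linear.linear linear_scale)
    have ct: "continuous_on (cball 0 r) (\<lambda>y. G' (x + t *\<^sub>R y) (t *\<^sub>R b) \<bullet> b)" if b: "b \<in> Basis" for b
    proof -
      have "continuous_on (cball 0 r) (\<lambda>y. t * (G' (x + t *\<^sub>R y) b \<bullet> b))"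
        by (intro continuous_intros continuous_on_compose2[OF cont[OF b]])
           (use inball True in auto)
      then show ?thesis by (rule continuous_on_eq) (use lin in simp)
    qed
    have tr: "(\<Sum>b\<in>Basis. G' (x + t *\<^sub>R y) (t *\<^sub>R b) \<bullet> b) \<ge> 0" if "y \<in> cball 0 r" for y
      using sub[OF inball[OF that]] True
      by (simp add: lin[OF that] flip: sum_distrib_left)
    have "2 * (LINT y:cball 0 r|lborel. y \<bullet> G (x + t *\<^sub>R y))
       = (LINT y:cball 0 r|lborel. (r\<^sup>2 - y \<bullet> y) * (\<Sum>b\<in>Basis. G' (x + t *\<^sub>R y) (t *\<^sub>R b) \<bullet> b))"
      by (rule integral_divergence_paraboloid[OF r tL dt ct]) auto
    also have "\<dots> \<ge> 0"
      unfolding set_lebesgue_integral_def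
      by (intro integral_nonneg_AE AE_I2)
         (use tr r in \<open>auto simp: indicator_def dot_square_norm\<close>)
    finally show ?thesis
      using True by (simp add: H_def set_lebesgue_integral_def)
  qed (simp add: H_def)
  have "integrable lborel (\<lambda>p. indicator ({0..1::real} \<times> cball (0::'a) r) p *\<^sub>R (snd p \<bullet> G (x + fst p *\<^sub>R snd p)))"
    by (intro borel_integrable_compact compact_Times continuous_intros continuous_on_compose2[OF cG])
       (use inball in auto)
  then have "integrable (lborel \<Otimes>\<^sub>M lborel) (\<lambda>(t, y). H t y)"
    unfolding lborel_prod H_def by (simp add: case_prod_unfold indicator_times)
  then have fub: "(\<integral>y. (\<integral>t. H t y \<partial>lborel) \<partial>lborel) = (\<integral>t. (\<integral>y. H t y \<partial>lborel) \<partial>lborel)"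
    by (rule lborel_pair.Fubini_integral)
  have ftc: "(\<integral>t. H t y \<partial>lborel) = indicator (cball 0 r) y * (f (x + y) - f x)" for y
  proof (cases "y \<in> cball 0 r")
    case True
    have "(\<integral>t. indicator {0..1} t *\<^sub>R (y \<bullet> G (x + t *\<^sub>R y)) \<partial>lborel) = f (x + 1 *\<^sub>R y) - f (x + 0 *\<^sub>R y)"
    proof (rule integral_FTC_Icc)
      fix t :: real assume t: "0 \<le> t" "t \<le> 1"
      have "((\<lambda>t. x + t *\<^sub>R y) has_derivative (\<lambda>s. s *\<^sub>R y)) (at t within {0..1})"
        by (auto intro!: derivative_eq_intros)
      from has_derivative_compose[OF this df[OF inball[OF True t]]]
      show "((\<lambda>t. f (x + t *\<^sub>R y)) has_vector_derivative y \<bullet> G (x + t *\<^sub>R y)) (at t within {0..1})"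
        by (simp add: has_vector_derivative_def inner_commute)
    qed (use inball[OF True] in \<open>auto intro!: continuous_intros continuous_on_compose2[OF cG]\<close>)
    then show ?thesis using True by (simp add: H_def)
  qed (simp add: H_def)
  have i1: "integrable lborel (\<lambda>y. indicator (cball 0 r) y *\<^sub>R f (x + y))"
    by (intro borel_integrable_compact continuous_on_compose2[OF cf] continuous_intros) auto
  have i2: "integrable lborel (\<lambda>y. indicator (cball (0::'a) r) y *\<^sub>R f x)"
    by (intro borel_integrable_compact continuous_intros) auto
  have "0 \<le> (\<integral>t. (\<integral>y. H t y \<partial>lborel) \<partial>lborel)"
    using inner_nonneg by (intro integral_nonneg_AE) auto
  also have "\<dots> = (\<integral>y. indicator (cball 0 r) y *\<^sub>R f (x + y) - indicator (cball 0 r) y *\<^sub>R f x \<partial>lborel)"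
    unfolding fub[symmetric] ftc by (simp add: algebra_simps)
  also have "\<dots> = (\<integral>y. indicator (cball 0 r) y *\<^sub>R f (x + y) \<partial>lborel) - measure lborel (cball (0::'a) r) * f x"
    using i1 i2 by simp
  also have "(\<integral>y. indicator (cball 0 r) y *\<^sub>R f (x + y) \<partial>lborel) = (LINT z:cball x r|lborel. f z)"
  proof -
    have "(\<lambda>z. indicator (cball x r) z *\<^sub>R f z) \<in> borel_measurable borel"
      using borel_integrable_compact[OF compact_cball cf] by (simp add: borel_measurable_integrable)
    from lborel_integral_translate[OF this, of x]
    show ?thesis
      by (simp add: set_lebesgue_integral_def indicator_def dist_norm add.commute)
  qed
  also have "measure lborel (cball (0::'a) r) = measure lborel (cball x r)"
    using r by (simp add: content_cball)
  finally show ?thesis by simp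
qed

section \<open>The fundamental solution and its regularization\<close>

text \<open>The antiderivative of \<open>s powr (- d / 2)\<close>: a radial function \<open>\<phi>(\<bar>x\<bar>\<^sup>2)\<close> on \<open>\<real>\<^sup>d\<close> is harmonic off the origin
exactly when \<open>\<phi>'\<close> is a constant multiple of this power.\<close>
definition radial_primitive :: "real \<Rightarrow> real \<Rightarrow> real" where
  "radial_primitive d s = (if d = 2 then ln s else s powr (1 - d / 2) / (1 - d / 2))"

lemma radial_primitive_deriv:
  assumes "s > 0"
  shows "(radial_primitive d has_real_derivative s powr (- d / 2)) (at s)"
proof (cases "d = 2")
  case True
  then have "radial_primitive d = ln" by (auto simp: radial_primitive_def)
  moreover have "s powr (- d / 2) = inverse s"
    using assms True by (simp add: powr_minus)
  ultimately show ?thesis using assms by (simp add: DERIV_ln)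
next
  case False
  then have "radial_primitive d = (\<lambda>s. s powr (1 - d / 2) / (1 - d / 2))"
    by (auto simp: radial_primitive_def)
  then show ?thesis using assms False
    by (auto intro!: derivative_eq_intros)
qed

lemma radial_primitive_strict_mono:
  assumes "0 < s" "s < t"
  shows "radial_primitive d s < radial_primitive d t"
  using assms(2)
proof (rule DERIV_pos_imp_increasing)
  fix u assume "s \<le> u" "u \<le> t"
  then show "\<exists>y. (radial_primitive d has_real_derivative y) (at u) \<and> 0 < y"
    using assms radial_primitive_deriv[of u d] by (intro exI[of _ "u powr (- d / 2)"]) auto
qed

lemma radial_primitive_mono:
  assumes "0 < s" "s \<le> t"
  shows "radial_primitive d s \<le> radial_primitive d t"
  using radial_primitive_strict_mono[of s t d] assms by (cases "s = t") auto

text \<open>For \<open>e = 0\<close> this is a positive multiple of the fundamental solution of the Laplacian, up to an additive constant; for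
\<open>e > 0\<close> it is a smooth subharmonic function. In dimension at least 2 the true value of the fundamental solution at the
origin is \<open>-\<infinity>\<close>, whereas here it is an arbitrary real; as a single point is null, no integral sees the difference.\<close>
definition newton_kernel :: "real \<Rightarrow> 'a::euclidean_space \<Rightarrow> real" where
  "newton_kernel e x = radial_primitive DIM('a) (x \<bullet> x + e)"

lemma newton_kernel_minus [simp]: "newton_kernel e (- x) = newton_kernel e x"
  by (simp add: newton_kernel_def)

lemma newton_kernel_minus_commute: "newton_kernel e (x - y) = newton_kernel e (y - x)"
  by (metis newton_kernel_minus minus_diff_eq)

lemma newton_kernel_measurable [measurable]: "newton_kernel e \<in> borel_measurable borel"
  unfolding newton_kernel_def radial_primitive_def by measurable

definition newton_grad :: "real \<Rightarrow> 'a::euclidean_space \<Rightarrow> 'a" where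
  "newton_grad e x = (2 * (x \<bullet> x + e) powr (- real DIM('a) / 2)) *\<^sub>R x"

definition newton_hess :: "real \<Rightarrow> 'a::euclidean_space \<Rightarrow> 'a \<Rightarrow> 'a" where
  "newton_hess e x h = (2 * (x \<bullet> x + e) powr (- real DIM('a) / 2)) *\<^sub>R h
     - (2 * real DIM('a) * (x \<bullet> x + e) powr (- real DIM('a) / 2 - 1) * (x \<bullet> h)) *\<^sub>R x"

lemma newton_kernel_has_derivative:
  fixes x :: "'a::euclidean_space"
  assumes "x \<bullet> x + e > 0"
  shows "(newton_kernel e has_derivative (\<lambda>h. newton_grad e x \<bullet> h)) (at x)"
proof -
  have "((\<lambda>x::'a. x \<bullet> x + e) has_derivative (\<lambda>h. 2 * (x \<bullet> h))) (at x)"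
    by (auto intro!: derivative_eq_intros simp: inner_commute)
  from has_derivative_compose[OF this, OF radial_primitive_deriv[OF assms, unfolded has_field_derivative_def, of "DIM('a)"]]
  show ?thesis
    by (simp add: newton_kernel_def[abs_def] newton_grad_def mult_ac)
qed

lemma newton_grad_has_derivative:
  fixes x :: "'a::euclidean_space"
  assumes "x \<bullet> x + e > 0"
  shows "(newton_grad e has_derivative newton_hess e x) (at x)"
proof -
  have 1: "((\<lambda>x::'a. x \<bullet> x + e) has_derivative (\<lambda>h. 2 * (x \<bullet> h))) (at x)"
    by (auto intro!: derivative_eq_intros simp: inner_commute)
  have "((\<lambda>s. s powr (- real DIM('a) / 2)) has_real_derivative (- real DIM('a) / 2) * (x \<bullet> x + e) powr (- real DIM('a) / 2 - 1)) (at (x \<bullet> x + e))"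
    using has_real_derivative_powr[OF assms, of "- real DIM('a) / 2"] by simp
  from has_derivative_compose[OF 1, OF this[unfolded has_field_derivative_def]]
  have "((\<lambda>x::'a. (x \<bullet> x + e) powr (- real DIM('a) / 2)) has_derivative
      (\<lambda>h. - real DIM('a) * (x \<bullet> x + e) powr (- real DIM('a) / 2 - 1) * (x \<bullet> h))) (at x)"
    by (simp add: mult_ac)
  from has_derivative_scaleR[OF has_derivative_mult_right[OF this, of 2] has_derivative_ident]
  show ?thesis
    unfolding newton_grad_def[abs_def] newton_hess_def[abs_def]
    by (simp add: algebra_simps)
qed

text \<open>The Laplacian of the regularized kernel. The terms that do not contain \<open>e\<close> cancel, so it is positive for \<open>e > 0\<close> and
zero for \<open>e = 0\<close>.\<close>
lemma newton_hess_trace: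
  fixes x :: "'a::euclidean_space" and e :: real
  assumes "x \<bullet> x + e > 0"
  shows "(\<Sum>b\<in>Basis. newton_hess e x b \<bullet> b) = 2 * real DIM('a) * e * (x \<bullet> x + e) powr (- real DIM('a) / 2 - 1)"
proof -
  define s where "s = x \<bullet> x + e"
  define q where "q = s powr (- real DIM('a) / 2 - 1)"
  have "s powr (- real DIM('a) / 2) = s powr (1 + (- real DIM('a) / 2 - 1))" by simp
  also have "\<dots> = s * q" using assms unfolding powr_add q_def s_def by simp
  finally have sq: "s powr (- real DIM('a) / 2) = s * q" .
  have "(\<Sum>b\<in>Basis. newton_hess e x b \<bullet> b)
      = (\<Sum>b\<in>(Basis::'a set). 2 * (s * q)) - (\<Sum>b\<in>Basis. 2 * real DIM('a) * q * ((x \<bullet> b) * (x \<bullet> b)))"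
    unfolding newton_hess_def s_def[symmetric] sq q_def[symmetric] sum_subtractf[symmetric]
    by (rule sum.cong) (auto simp: inner_diff_left)
  also have "\<dots> = DIM('a) * (2 * (s * q)) - 2 * real DIM('a) * q * (x \<bullet> x)"
    by (simp add: sum_distrib_left[symmetric] euclidean_inner[of x x])
  also have "\<dots> = 2 * real DIM('a) * e * q" by (simp add: s_def algebra_simps)
  finally show ?thesis by (simp add: q_def s_def)
qed

text \<open>A bound in terms of a lower bound \<open>m\<close> for \<open>\<bar>x\<bar>\<^sup>2 + e\<close> only, which makes the gradient Lipschitz on every ball that
keeps away from the singularity.\<close>
lemma newton_hess_norm_le:
  fixes x :: "'a::euclidean_space" and e :: real
  assumes "e \<ge> 0" "m > 0" "m \<le> x \<bullet> x + e"
  shows "norm (newton_hess e x h) \<le> (2 + 2 * real DIM('a)) * m powr (- real DIM('a) / 2) * norm h"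
proof -
  define s where "s = x \<bullet> x + e"
  have s: "0 < m" "m \<le> s" using assms by (auto simp: s_def)
  define q where "q = s powr (- real DIM('a) / 2 - 1)"
  have "s powr (- real DIM('a) / 2) = s powr (1 + (- real DIM('a) / 2 - 1))" by simp
  also have "\<dots> = s * q" using s unfolding powr_add q_def by simp
  finally have sq: "s powr (- real DIM('a) / 2) = s * q" .
  have q0: "q \<ge> 0" by (simp add: q_def)
  have "norm (newton_hess e x h) \<le> norm ((2 * (s * q)) *\<^sub>R h) + norm ((2 * real DIM('a) * q * (x \<bullet> h)) *\<^sub>R x)"
    unfolding newton_hess_def s_def[symmetric] sq q_def[symmetric] by (rule norm_triangle_ineq4)
  also have "norm ((2 * (s * q)) *\<^sub>R h) = 2 * (s * q) * norm h"
    using s q0 by simp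
  also have "norm ((2 * real DIM('a) * q * (x \<bullet> h)) *\<^sub>R x) = 2 * real DIM('a) * q * (\<bar>x \<bullet> h\<bar> * norm x)"
    using q0 by (simp add: abs_mult)
  also have "\<dots> \<le> 2 * real DIM('a) * q * (s * norm h)"
  proof (intro mult_left_mono)
    have "\<bar>x \<bullet> h\<bar> * norm x \<le> norm x * norm h * norm x"
      by (intro mult_right_mono Cauchy_Schwarz_ineq2) auto
    also have "\<dots> = (x \<bullet> x) * norm h" by (simp add: dot_square_norm power2_eq_square)
    also have "\<dots> \<le> s * norm h" using assms by (intro mult_right_mono) (auto simp: s_def)
    finally show "\<bar>x \<bullet> h\<bar> * norm x \<le> s * norm h" .
  qed (use q0 in auto)
  finally have "norm (newton_hess e x h) \<le> (2 + 2 * real DIM('a)) * (s * q) * norm h"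
    by (simp add: algebra_simps)
  also have "\<dots> \<le> (2 + 2 * real DIM('a)) * m powr (- real DIM('a) / 2) * norm h"
    unfolding sq[symmetric] using s by (intro mult_right_mono mult_left_mono powr_mono2') auto
  finally show ?thesis .
qed

text \<open>If \<open>e > 0\<close> or the pole \<open>a\<close> lies off the ball, the kernel is smooth on the ball, so the mean value inequality
applies; for \<open>e = 0\<close> its Laplacian vanishes and the inequality also holds for the negative of the kernel.\<close>
lemma newton_kernel_mean_value:
  fixes x a :: "'a::euclidean_space"
  assumes r: "r > 0" and e: "e \<ge> 0" and off: "e > 0 \<or> a \<notin> cball x r"
  shows "measure lborel (cball x r) * newton_kernel e (x - a) \<le> (LINT z:cball x r|lborel. newton_kernel e (z - a))" (is ?le)
    and "e = 0 \<Longrightarrow> (LINT z:cball x r|lborel. newton_kernel e (z - a)) = measure lborel (cball x r) * newton_kernel e (x - a)"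
proof -
  have pos: "(z - a) \<bullet> (z - a) + e > 0" if "z \<in> cball x r" for z
    using off e that by (cases "z = a") (auto intro: add_pos_nonneg)
  have cs: "continuous_on (cball x r) (\<lambda>z. (z - a) \<bullet> (z - a) + e)"
    by (intro continuous_intros)
  obtain z0 where z0: "z0 \<in> cball x r" "\<And>z. z \<in> cball x r \<Longrightarrow> (z0 - a) \<bullet> (z0 - a) + e \<le> (z - a) \<bullet> (z - a) + e"
    using continuous_attains_inf[OF compact_cball _ cs] r by auto
  define m where "m = (z0 - a) \<bullet> (z0 - a) + e"
  have m: "m > 0" "\<And>z. z \<in> cball x r \<Longrightarrow> m \<le> (z - a) \<bullet> (z - a) + e"
    using z0 pos by (auto simp: m_def)
  have sh: "((\<lambda>z. z - a) has_derivative (\<lambda>h. h)) (at z)" for z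
    by (auto intro!: derivative_eq_intros)
  have df: "((\<lambda>z. newton_kernel e (z - a)) has_derivative (\<lambda>h. newton_grad e (z - a) \<bullet> h)) (at z)"
    if "z \<in> cball x r" for z
    using has_derivative_compose[OF sh newton_kernel_has_derivative[OF pos[OF that]]] .
  have dG: "((\<lambda>z. newton_grad e (z - a)) has_derivative newton_hess e (z - a)) (at z)"
    if "z \<in> cball x r" for z
    using has_derivative_compose[OF sh newton_grad_has_derivative[OF pos[OF that]]] .
  define L where "L = (2 + 2 * real DIM('a)) * m powr (- real DIM('a) / 2)"
  have lip: "L-lipschitz_on (cball x r) (\<lambda>z. newton_grad e (z - a))"
  proof (rule bounded_derivative_imp_lipschitz)
    show "((\<lambda>z. newton_grad e (z - a)) has_derivative newton_hess e (z - a)) (at z within cball x r)"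
      if "z \<in> cball x r" for z
      using dG[OF that] by (rule has_derivative_at_withinI)
    show "onorm (newton_hess e (z - a)) \<le> L" if "z \<in> cball x r" for z
      unfolding L_def using newton_hess_norm_le[OF e m(1) m(2)[OF that]] by (intro onorm_le)
  qed (auto simp: L_def)
  have ch: "continuous_on (cball x r) (\<lambda>z. newton_hess e (z - a) b \<bullet> b)" for b
    unfolding newton_hess_def
    by (intro continuous_intros) (use pos in \<open>auto simp: less_imp_neq[symmetric]\<close>)
  have tr: "(\<Sum>b\<in>Basis. newton_hess e (z - a) b \<bullet> b) = 2 * real DIM('a) * e * ((z - a) \<bullet> (z - a) + e) powr (- real DIM('a) / 2 - 1)"
    if "z \<in> cball x r" for z
    by (rule newton_hess_trace[OF pos[OF that]])
  show le: ?le
    by (rule subharmonic_C2_mean_value[OF r df dG lip ch]) (use tr e in auto)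
  assume e0: "e = 0"
  have "measure lborel (cball x r) * (- newton_kernel e (x - a)) \<le> (LINT z:cball x r|lborel. - newton_kernel e (z - a))"
  proof (rule subharmonic_C2_mean_value[OF r])
    fix z assume z: "z \<in> cball x r"
    show "((\<lambda>z. - newton_kernel e (z - a)) has_derivative (\<lambda>h. - newton_grad e (z - a) \<bullet> h)) (at z)"
      using has_derivative_minus[OF df[OF z]] by simp
    show "((\<lambda>z. - newton_grad e (z - a)) has_derivative (\<lambda>h. - newton_hess e (z - a) h)) (at z)"
      by (rule has_derivative_minus[OF dG[OF z]])
    show "0 \<le> (\<Sum>b\<in>Basis. - newton_hess e (z - a) b \<bullet> b)"
      using tr[OF z] e0 by (simp add: sum_negf)
  next
    show "L-lipschitz_on (cball x r) (\<lambda>z. - newton_grad e (z - a))"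
      using lip by (simp add: lipschitz_on_minus)
    show "continuous_on (cball x r) (\<lambda>z. - newton_hess e (z - a) b \<bullet> b)" for b
      using continuous_on_minus[OF ch[of b]] by simp
  qed
  with le show "(LINT z:cball x r|lborel. newton_kernel e (z - a)) = measure lborel (cball x r) * newton_kernel e (x - a)"
    by (simp add: set_lebesgue_integral_def)
qed

lemma cball_in_borel [measurable]: "cball x r \<in> sets (borel :: 'a::euclidean_space measure)"
  by simp

lemma newton_kernel_mono:
  assumes "x \<noteq> 0 \<or> d > 0" "0 \<le> d" "d \<le> e"
  shows "newton_kernel d x \<le> newton_kernel e x"
proof -
  have "0 < x \<bullet> x + d"
    using assms by (cases "x = 0") (auto intro: add_pos_nonneg)
  then show ?thesis
    using assms by (auto simp: newton_kernel_def intro: radial_primitive_mono)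
qed

lemma newton_kernel_radial_mono:
  fixes x y :: "'a::euclidean_space"
  assumes "x \<noteq> 0" "norm x \<le> norm y"
  shows "newton_kernel 0 x \<le> newton_kernel 0 y"
proof -
  have "x \<bullet> x \<le> y \<bullet> y" using assms by (simp add: dot_square_norm)
  then show ?thesis using assms by (auto simp: newton_kernel_def intro: radial_primitive_mono)
qed

lemma newton_kernel_eq_imp_norm_eq:
  fixes x y :: "'a::euclidean_space"
  assumes "x \<noteq> 0" "y \<noteq> 0" "newton_kernel 0 x = newton_kernel 0 y"
  shows "norm x = norm y"
proof -
  have less: "newton_kernel 0 u < newton_kernel 0 v" if "u \<noteq> 0" "norm u < norm v" for u v :: 'a
  proof -
    have "u \<bullet> u < v \<bullet> v" using that by (simp add: dot_square_norm power_strict_mono)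
    then show ?thesis using that by (auto simp: newton_kernel_def intro: radial_primitive_strict_mono)
  qed
  show ?thesis
    using less[of x y] less[of y x] assms by fastforce
qed

lemma newton_kernel_continuous_on:
  fixes S :: "'a::euclidean_space set"
  assumes "\<And>x. x \<in> S \<Longrightarrow> x \<bullet> x + e > 0"
  shows "continuous_on S (newton_kernel e)"
  using newton_kernel_has_derivative[OF assms] by (meson continuous_at_imp_continuous_on has_derivative_continuous)

lemma newton_kernel_tendsto:
  fixes x :: "'a::euclidean_space"
  assumes "x \<noteq> 0"
  shows "(\<lambda>n. newton_kernel (1 / Suc n) x) \<longlonglongrightarrow> newton_kernel 0 x"
proof -
  have p: "x \<bullet> x > 0" using assms by simp
  have "isCont (radial_primitive DIM('a)) (x \<bullet> x)"
    using radial_primitive_deriv[OF p] by (rule DERIV_isCont)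
  moreover have "(\<lambda>n. x \<bullet> x + 1 / Suc n) \<longlonglongrightarrow> x \<bullet> x"
    using LIMSEQ_inverse_real_of_nat_add[of "x \<bullet> x"] unfolding inverse_eq_divide .
  ultimately have "(\<lambda>n. radial_primitive DIM('a) (x \<bullet> x + 1 / Suc n)) \<longlonglongrightarrow> radial_primitive DIM('a) (x \<bullet> x)"
    by (rule isCont_tendsto_compose)
  then show ?thesis by (simp only: newton_kernel_def add_0_right)
qed

text \<open>Here the pole \<open>a\<close> may lie in the ball. The regularized kernels decrease to the singular one while their integrals
stay bounded below by the value at the centre, so monotone convergence gives both the integrability of the singularity and
the mean value inequality. No integral of a power of the norm has to be computed.\<close>
lemma newton_kernel_sub_mean_value:
  fixes x a :: "'a::euclidean_space"
  assumes r: "r > 0" and xa: "x \<noteq> a"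
  shows "set_integrable lborel (cball x r) (\<lambda>z. newton_kernel 0 (z - a))"
    and "measure lborel (cball x r) * newton_kernel 0 (x - a) \<le> (LINT z:cball x r|lborel. newton_kernel 0 (z - a))"
proof -
  \<comment> \<open>the sign makes the sequence increasing, and \<open>B\<close> bounds its integrals from above\<close>
  define f where "f n z = - (indicator (cball x r) z * newton_kernel (1 / Suc n) (z - a))" for n z
  define u where "u z = - (indicator (cball x r) z * newton_kernel 0 (z - a))" for z
  define B where "B = - (measure lborel (cball x r) * newton_kernel 0 (x - a))"
  have fi: "integrable lborel (f n)" for n
  proof -
    have "continuous_on (cball x r) (\<lambda>z. newton_kernel (1 / Suc n) (z - a))"
      by (intro continuous_on_compose2[OF newton_kernel_continuous_on[of UNIV]] continuous_intros)
         (auto intro: add_nonneg_pos)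
    from borel_integrable_compact[OF compact_cball this]
    show ?thesis unfolding f_def by simp
  qed
  have ptmono: "f m z \<le> f n z" if "z \<noteq> a" "m \<le> n" for m n z
    unfolding f_def using that
    by (auto simp: indicator_def intro!: newton_kernel_mono divide_left_mono)
  then have fmono: "AE z in lborel. mono (\<lambda>n. f n z)"
    using AE_lborel_singleton[of a] by (auto simp: mono_def)
  have flim: "AE z in lborel. (\<lambda>n. f n z) \<longlonglongrightarrow> u z"
    using AE_lborel_singleton[of a]
    by eventually_elim (auto simp: f_def u_def simp del: of_nat_Suc intro!: tendsto_intros newton_kernel_tendsto)
  have inc: "incseq (\<lambda>n. \<integral>z. f n z \<partial>lborel)"
    unfolding incseq_def using AE_lborel_singleton[of a] ptmono by (auto intro!: integral_mono_AE fi)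
  have bd: "(\<integral>z. f n z \<partial>lborel) \<le> B" for n
  proof -
    have "measure lborel (cball x r) * newton_kernel 0 (x - a) \<le> measure lborel (cball x r) * newton_kernel (1 / Suc n) (x - a)"
      using xa by (intro mult_left_mono newton_kernel_mono) auto
    also have "\<dots> \<le> (LINT z:cball x r|lborel. newton_kernel (1 / Suc n) (z - a))"
      using newton_kernel_mean_value(1)[OF r, of "1 / Suc n"] by simp
    finally show ?thesis by (simp add: B_def f_def set_lebesgue_integral_def)
  qed
  have "\<forall>n. (\<integral>z. f n z \<partial>lborel) \<le> B" using bd by simp
  with inc obtain X where X: "(\<lambda>n. \<integral>z. f n z \<partial>lborel) \<longlonglongrightarrow> X"
    by (rule incseq_convergent)
  have XB: "X \<le> B" by (rule LIMSEQ_le_const2[OF X]) (use bd in auto)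
  have um: "u \<in> borel_measurable lborel" unfolding u_def by measurable
  note c = integrable_monotone_convergence[OF fi fmono flim X um]
    integral_monotone_convergence[OF fi fmono flim X um]
  show "set_integrable lborel (cball x r) (\<lambda>z. newton_kernel 0 (z - a))"
    using c(1) by (simp add: set_integrable_def u_def[abs_def])
  show "measure lborel (cball x r) * newton_kernel 0 (x - a) \<le> (LINT z:cball x r|lborel. newton_kernel 0 (z - a))"
  proof -
    have "(LINT z:cball x r|lborel. newton_kernel 0 (z - a)) = - (\<integral>z. u z \<partial>lborel)"
      by (simp add: set_lebesgue_integral_def u_def)
    also have "\<dots> = - X" using c(2) by (simp only:)
    finally show ?thesis using XB unfolding B_def by linarith
  qed
qed

lemma set_integral_translate_le:
  fixes g :: "'a::euclidean_space \<Rightarrow> real"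
  assumes g: "set_integrable lborel (cball 0 \<rho>) g" and [measurable]: "g \<in> borel_measurable borel" "S \<in> sets borel"
    and S: "\<And>x. x \<in> S \<Longrightarrow> norm (x - y) \<le> \<rho>"
  shows "set_integrable lborel S (\<lambda>x. g (x - y))"
    and "(LINT x:S|lborel. \<bar>g (x - y)\<bar>) \<le> (LINT x:cball 0 \<rho>|lborel. \<bar>g x\<bar>)"
proof -
  define h where "h x = indicator (cball 0 \<rho>) x * \<bar>g x\<bar>" for x
  have h: "integrable lborel h"
    using set_integrable_abs[OF g] by (simp add: h_def[abs_def] set_integrable_def)
  have ht: "integrable lborel (\<lambda>x. h (x + (- y)))"
    by (rule lborel_integrable_translate[OF h])
  have le: "indicator S x * \<bar>g (x - y)\<bar> \<le> h (x + (- y))" for x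
    using S[of x] by (auto simp: h_def indicator_def)
  show 1: "set_integrable lborel S (\<lambda>x. g (x - y))"
    unfolding set_integrable_def
  proof (rule Bochner_Integration.integrable_bound[OF ht])
    show "AE x in lborel. norm (indicator S x *\<^sub>R g (x - y)) \<le> norm (h (x + - y))"
    proof (rule AE_I2)
      fix x show "norm (indicator S x *\<^sub>R g (x - y)) \<le> norm (h (x + - y))"
        using le[of x] by (simp add: abs_mult)
    qed
  qed measurable
  have "(LINT x:S|lborel. \<bar>g (x - y)\<bar>) \<le> (\<integral>x. h (x + (- y)) \<partial>lborel)"
    unfolding set_lebesgue_integral_def
    by (rule integral_mono) (use set_integrable_abs[OF 1] ht le in \<open>auto simp: set_integrable_def\<close>)
  also have "\<dots> = (\<integral>x. h x \<partial>lborel)"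
    by (rule lborel_integral_translate) (use h in \<open>simp add: borel_measurable_integrable\<close>)
  finally show "(LINT x:S|lborel. \<bar>g (x - y)\<bar>) \<le> (LINT x:cball 0 \<rho>|lborel. \<bar>g x\<bar>)"
    by (simp add: h_def[abs_def] set_lebesgue_integral_def)
qed

text \<open>For \<open>e = 0\<close>, the ball about the origin is contained in a larger ball with centre different from the pole, to which
the mean value inequality applies.\<close>
lemma newton_kernel_integrable_cball:
  assumes "e \<ge> 0"
  shows "set_integrable lborel (cball (0::'a::euclidean_space) \<rho>) (newton_kernel e)"
proof (cases "e = 0")
  case False
  have "continuous_on (cball (0::'a) \<rho>) (newton_kernel e)"
    by (rule newton_kernel_continuous_on) (use assms False in \<open>auto intro: add_nonneg_pos\<close>)
  from borel_integrable_compact[OF compact_cball this] show ?thesis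
    by (simp add: set_integrable_def)
next
  case True
  obtain b :: 'a where b: "b \<in> Basis" using nonempty_Basis by blast
  have big: "set_integrable lborel (cball b (\<bar>\<rho>\<bar> + 1)) (\<lambda>z. newton_kernel 0 (z - 0))"
    by (rule newton_kernel_sub_mean_value) (use b in auto)
  have "cball 0 \<rho> \<subseteq> cball b (\<bar>\<rho>\<bar> + 1)"
  proof
    fix z :: 'a assume "z \<in> cball 0 \<rho>"
    then show "z \<in> cball b (\<bar>\<rho>\<bar> + 1)"
      using norm_triangle_ineq4[of b z] b by (simp add: dist_norm)
  qed
  with big have "set_integrable lborel (cball 0 \<rho>) (\<lambda>z::'a. newton_kernel 0 (z - 0))"
    by (intro set_integrable_subset[OF big]) auto
  then show ?thesis using True by simp
qed

section \<open>Potentials of bounded sets\<close>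

definition potential :: "real \<Rightarrow> 'a::euclidean_space set \<Rightarrow> 'a \<Rightarrow> real" where
  "potential e S y = (LINT x:S|lborel. newton_kernel e (x - y))"

lemma bounded_diff_norm_le:
  fixes S :: "'a::real_normed_vector set"
  assumes "bounded S" "bounded T"
  obtains \<rho> where "\<And>x y. x \<in> S \<Longrightarrow> y \<in> T \<Longrightarrow> norm (x - y) \<le> \<rho>"
proof -
  obtain a b where "\<And>x. x \<in> S \<Longrightarrow> norm x \<le> a" "\<And>y. y \<in> T \<Longrightarrow> norm y \<le> b"
    using assms by (auto simp: bounded_iff)
  then have "norm (x - y) \<le> a + b" if "x \<in> S" "y \<in> T" for x y
    using that norm_triangle_ineq4[of x y] by fastforce
  then show ?thesis by (rule that)
qed

lemma newton_kernel_integrable: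
  fixes S :: "'a::euclidean_space set"
  assumes "e \<ge> 0" "bounded S" "S \<in> sets borel"
  shows "set_integrable lborel S (\<lambda>x. newton_kernel e (x - y))"
proof -
  obtain \<rho> where "\<And>x y'. x \<in> S \<Longrightarrow> y' \<in> {y} \<Longrightarrow> norm (x - y') \<le> \<rho>"
    using bounded_diff_norm_le[OF assms(2), of "{y}"] by auto
  then show ?thesis
    using set_integral_translate_le(1)[OF newton_kernel_integrable_cball[OF assms(1)] newton_kernel_measurable assms(3)]
    by blast
qed

lemma potential_regularized_continuous:
  fixes S :: "'a::euclidean_space set"
  assumes e: "e > 0" and S: "bounded S" and [measurable]: "S \<in> sets borel" and T: "bounded T"
  shows "continuous_on T (potential e S)"
  unfolding continuous_on_sequentially
proof (intro ballI allI impI)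
  fix X y assume y: "y \<in> T" and X: "(\<forall>n. X n \<in> T) \<and> X \<longlonglongrightarrow> y"
  obtain \<rho> where \<rho>: "\<And>x z. x \<in> S \<Longrightarrow> z \<in> T \<Longrightarrow> norm (x - z) \<le> \<rho>"
    using bounded_diff_norm_le[OF S T] by blast
  have c: "continuous_on A (newton_kernel e)" for A :: "'a set"
    by (rule newton_kernel_continuous_on) (use e in \<open>auto intro: add_nonneg_pos\<close>)
  obtain M where M: "\<And>u::'a. norm u \<le> \<rho> \<Longrightarrow> \<bar>newton_kernel e u\<bar> \<le> M"
    using compact_imp_bounded[OF compact_continuous_image[OF c compact_cball[of 0 \<rho>]]]
    by (force simp: bounded_iff)
  have "(\<lambda>n. \<integral>x. indicator S x *\<^sub>R newton_kernel e (x - X n) \<partial>lborel)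
      \<longlonglongrightarrow> (\<integral>x. indicator S x *\<^sub>R newton_kernel e (x - y) \<partial>lborel)"
  proof (rule integral_dominated_convergence[where w = "\<lambda>x. indicator S x * M"])
    show "integrable lborel (\<lambda>x. indicator S x * M)"
      using emeasure_bounded_finite[OF S] by (auto simp: integrable_indicator_iff)
    show "AE x in lborel. (\<lambda>n. indicator S x *\<^sub>R newton_kernel e (x - X n)) \<longlonglongrightarrow> indicator S x *\<^sub>R newton_kernel e (x - y)"
      using X c[of UNIV]
      by (intro AE_I2 tendsto_intros continuous_on_tendsto_compose[OF c[of UNIV]]) auto
    show "AE x in lborel. norm (indicator S x *\<^sub>R newton_kernel e (x - X n)) \<le> indicator S x * M" for n
      using M[OF \<rho>, of _ "X n"] X by (intro AE_I2) (auto simp: indicator_def)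
  qed auto
  then show "(potential e S \<circ> X) \<longlonglongrightarrow> potential e S y"
    by (simp add: potential_def[abs_def] set_lebesgue_integral_def comp_def)
qed

text \<open>The difference is at most the integral of \<open>newton_kernel (1 / (n + 1)) - newton_kernel 0\<close> over one fixed ball about
the origin, whatever the point \<open>y \<in> T\<close>. This is what transfers continuity to the singular potential.\<close>
lemma potential_regularized_uniform_limit:
  fixes S :: "'a::euclidean_space set"
  assumes S: "bounded S" and [measurable]: "S \<in> sets borel" and T: "bounded T"
  shows "uniform_limit T (\<lambda>n. potential (1 / Suc n) S) (potential 0 S) sequentially"
proof -
  obtain \<rho> where \<rho>: "\<And>x z. x \<in> S \<Longrightarrow> z \<in> T \<Longrightarrow> norm (x - z) \<le> \<rho>"
    using bounded_diff_norm_le[OF S T] by blast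
  define g where "g n u = newton_kernel (1 / Suc n) u - newton_kernel 0 u" for n and u :: 'a
  have [measurable]: "g n \<in> borel_measurable borel" for n unfolding g_def by measurable
  have gi: "set_integrable lborel (cball 0 \<rho>) (g n)" for n
    unfolding g_def by (intro set_integral_diff newton_kernel_integrable_cball) auto
  define \<delta> where "\<delta> n = (LINT x:cball 0 \<rho>|lborel. \<bar>g n x\<bar>)" for n
  have "\<delta> \<longlonglongrightarrow> (\<integral>x. 0 \<partial>(lborel :: 'a measure))"
    unfolding \<delta>_def set_lebesgue_integral_def
  proof (rule integral_dominated_convergence[where w = "\<lambda>x. indicator (cball 0 \<rho>) x *\<^sub>R \<bar>g 0 x\<bar>"])
    show "integrable lborel (\<lambda>x. indicator (cball 0 \<rho>) x *\<^sub>R \<bar>g 0 x\<bar>)"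
      using set_integrable_abs[OF gi] by (simp add: set_integrable_def)
    show "AE x in lborel. (\<lambda>n. indicator (cball 0 \<rho>) x *\<^sub>R \<bar>g n x\<bar>) \<longlonglongrightarrow> 0"
      using AE_lborel_singleton[of 0]
    proof eventually_elim
      case (elim x)
      have "(\<lambda>n. indicator (cball 0 \<rho>) x *\<^sub>R \<bar>g n x\<bar>) \<longlonglongrightarrow> indicator (cball 0 \<rho>) x *\<^sub>R \<bar>newton_kernel 0 x - newton_kernel 0 x\<bar>"
        unfolding g_def by (intro tendsto_intros newton_kernel_tendsto elim)
      then show ?case by simp
    qed
    show "AE x in lborel. norm (indicator (cball 0 \<rho>) x *\<^sub>R \<bar>g n x\<bar>) \<le> indicator (cball 0 \<rho>) x *\<^sub>R \<bar>g 0 x\<bar>" for n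
      using AE_lborel_singleton[of 0]
    proof eventually_elim
      case (elim x)
      have "newton_kernel 0 x \<le> newton_kernel (1 / Suc n) x" "newton_kernel (1 / Suc n) x \<le> newton_kernel (1 / Suc 0) x"
        using elim by (auto intro!: newton_kernel_mono simp: divide_le_eq)
      then show ?case by (auto simp: g_def indicator_def)
    qed
  qed measurable
  then have \<delta>0: "\<delta> \<longlonglongrightarrow> 0" by simp
  have diff: "\<bar>potential (1 / Suc n) S y - potential 0 S y\<bar> \<le> \<delta> n" if y: "y \<in> T" for n y
  proof -
    have "potential (1 / Suc n) S y - potential 0 S y = (LINT x:S|lborel. g n (x - y))"
      unfolding potential_def g_def
      using S by (intro set_integral_diff(2)[symmetric] newton_kernel_integrable) auto
    also have "\<bar>\<dots>\<bar> \<le> (LINT x:S|lborel. \<bar>g n (x - y)\<bar>)"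
      unfolding set_lebesgue_integral_def by (rule order_trans[OF integral_abs_bound]) (simp add: abs_mult)
    also have "\<dots> \<le> \<delta> n"
      unfolding \<delta>_def using \<rho> y by (intro set_integral_translate_le(2) gi) auto
    finally show ?thesis .
  qed
  show ?thesis
  proof (rule uniform_limitI)
    fix \<epsilon> :: real assume "\<epsilon> > 0"
    then have "\<forall>\<^sub>F n in sequentially. \<delta> n < \<epsilon>"
      using \<delta>0 by (auto dest: order_tendstoD(2))
    then show "\<forall>\<^sub>F n in sequentially. \<forall>y\<in>T. dist (potential (1 / Suc n) S y) (potential 0 S y) < \<epsilon>"
      by eventually_elim (auto simp: dist_real_def simp del: of_nat_Suc intro: le_less_trans[OF diff])
  qed
qed

lemma potential_continuous:
  fixes S :: "'a::euclidean_space set"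
  assumes S: "bounded S" "S \<in> sets borel"
  shows "continuous_on UNIV (potential 0 S)"
proof -
  have "continuous_on (ball 0 R) (potential 0 S)" for R
    by (rule uniform_limit_theorem[OF _ potential_regularized_uniform_limit[OF S]])
       (auto intro!: always_eventually potential_regularized_continuous S)
  then have "isCont (potential 0 S) y" for y
    by (rule continuous_on_interior[of "ball 0 (norm y + 1)"]) auto
  then show ?thesis by (simp add: continuous_at_imp_continuous_on)
qed

lemma potential_tendsto:
  fixes S :: "'a::euclidean_space set"
  assumes S: "bounded S" "S \<in> sets borel"
  shows "(\<lambda>n. potential (1 / Suc n) S y) \<longlonglongrightarrow> potential 0 S y"
  using potential_regularized_uniform_limit[OF S, of "{y}"] by (auto intro: tendsto_uniform_limitI)

text \<open>Fubini for the even kernel. The potential of a ball thus encodes the averages over this ball of all other potentials.\<close>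
lemma potential_symmetric:
  fixes S T :: "'a::euclidean_space set"
  assumes S: "bounded S" and [measurable]: "S \<in> sets borel"
    and T: "bounded T" and [measurable]: "T \<in> sets borel"
  shows "(LINT y:T|lborel. potential 0 S y) = (LINT x:S|lborel. potential 0 T x)"
proof -
  obtain \<rho> where \<rho>: "\<And>x z. x \<in> T \<Longrightarrow> z \<in> S \<Longrightarrow> norm (x - z) \<le> \<rho>"
    using bounded_diff_norm_le[OF T S] by blast
  define H where "H x y = indicator S x * (indicator T y * newton_kernel 0 (y - x))" for x y
  define C where "C = (LINT u:cball (0::'a) \<rho>|lborel. \<bar>newton_kernel 0 u\<bar>)"
  have [measurable]: "case_prod H \<in> borel_measurable (lborel \<Otimes>\<^sub>M lborel)"
    unfolding H_def by measurable
  have Ti: "integrable lborel (\<lambda>y. indicator T y * newton_kernel 0 (y - x))" for x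
    using newton_kernel_integrable[OF _ T, of 0 x] by (simp add: set_integrable_def)
  have "integrable (lborel \<Otimes>\<^sub>M lborel) (case_prod H)"
  proof (rule lborel_pair.Fubini_integrable)
    show "integrable lborel (\<lambda>x. \<integral>y. norm (case_prod H (x, y)) \<partial>lborel)"
    proof (rule Bochner_Integration.integrable_bound[where f = "\<lambda>x. indicator S x * C"])
      show "integrable lborel (\<lambda>x. indicator S x * C)"
        using emeasure_bounded_finite[OF S] by (auto simp: integrable_indicator_iff)
      have "norm (\<integral>y. norm (case_prod H (x, y)) \<partial>lborel) \<le> norm (indicator S x * C)" for x
      proof (cases "x \<in> S")
        case True
        have "(\<integral>y. norm (case_prod H (x, y)) \<partial>lborel) = (LINT y:T|lborel. \<bar>newton_kernel 0 (y - x)\<bar>)"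
          using True by (simp add: H_def set_lebesgue_integral_def abs_mult)
        moreover have "\<dots> \<le> C"
          unfolding C_def using \<rho> True
          by (intro set_integral_translate_le(2) newton_kernel_integrable_cball) auto
        moreover have "0 \<le> (\<integral>y. norm (case_prod H (x, y)) \<partial>lborel)"
          by (intro integral_nonneg_AE) auto
        ultimately show ?thesis using True by simp
      qed (simp add: H_def)
      then show "AE x in lborel. norm (\<integral>y. norm (case_prod H (x, y)) \<partial>lborel) \<le> norm (indicator S x * C)"
        by simp
    qed measurable
    show "AE x in lborel. integrable lborel (\<lambda>y. case_prod H (x, y))"
      using Ti by (simp add: H_def)
  qed measurable
  from lborel_pair.Fubini_integral[OF this]
  have "(\<integral>y. (\<integral>x. H x y \<partial>lborel) \<partial>lborel) = (\<integral>x. (\<integral>y. H x y \<partial>lborel) \<partial>lborel)" .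
  moreover have "(\<integral>x. H x y \<partial>lborel) = indicator T y * potential 0 S y" for y
  proof -
    have "(\<integral>x. H x y \<partial>lborel) = (\<integral>x. indicator T y * (indicator S x * newton_kernel 0 (x - y)) \<partial>lborel)"
      by (intro Bochner_Integration.integral_cong) (auto simp: H_def newton_kernel_minus_commute[of 0 y])
    then show ?thesis by (simp add: potential_def set_lebesgue_integral_def)
  qed
  moreover have "(\<integral>y. H x y \<partial>lborel) = indicator S x * potential 0 T x" for x
    by (simp add: H_def potential_def set_lebesgue_integral_def)
  ultimately show ?thesis by (simp add: set_lebesgue_integral_def)
qed

section \<open>The excess of ball averages over the value at the centre\<close>

text \<open>The volume of the ball times the amount by which the average, over the ball about \<open>y\<close>, of the kernel with pole \<open>x\<close>
exceeds its value at \<open>y\<close>. It is regarded as a function of the pole, since potentials integrate over poles.\<close>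
definition mean_excess :: "'a::euclidean_space \<Rightarrow> real \<Rightarrow> 'a \<Rightarrow> real" where
  "mean_excess y r x = potential 0 (cball y r) x - measure lborel (cball y r) * newton_kernel 0 (x - y)"

lemma mean_excess_nonneg:
  assumes "r > 0" "x \<noteq> y"
  shows "mean_excess y r x \<ge> 0"
  using newton_kernel_sub_mean_value(2)[of r y x] assms
  unfolding mean_excess_def potential_def newton_kernel_minus_commute[of 0 x y] by simp

lemma mean_excess_outside:
  assumes "r > 0" "x \<notin> cball y r"
  shows "mean_excess y r x = 0"
  using newton_kernel_mean_value(2)[of r 0 x y] assms
  unfolding mean_excess_def potential_def newton_kernel_minus_commute[of 0 x y] by simp

lemma mean_excess_integral:
  assumes "bounded S" "S \<in> sets borel"
  shows "set_integrable lborel S (mean_excess y r)"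
  and "(LINT x:S|lborel. mean_excess y r x)
     = (LINT z:cball y r|lborel. potential 0 S z) - measure lborel (cball y r) * potential 0 S y"
proof -
  have 1: "set_integrable lborel S (potential 0 (cball y r))"
  proof (rule set_integrable_subset)
    show "set_integrable lborel (closure S) (potential 0 (cball y r))"
      unfolding set_integrable_def
      by (rule borel_integrable_compact)
         (use assms in \<open>auto intro: continuous_on_subset[OF potential_continuous]\<close>)
  qed (use assms closure_subset in auto)
  have 2: "set_integrable lborel S (\<lambda>x. measure lborel (cball y r) * newton_kernel 0 (x - y))"
    by (intro set_integrable_mult_right newton_kernel_integrable) (use assms in auto)
  show "set_integrable lborel S (mean_excess y r)"
    unfolding mean_excess_def by (rule set_integral_diff(1)[OF 1 2])
  have "(LINT x:S|lborel. mean_excess y r x) = (LINT x:S|lborel. potential 0 (cball y r) x) - (LINT x:S|lborel. measure lborel (cball y r) * newton_kernel 0 (x - y))"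
    unfolding mean_excess_def by (rule set_integral_diff(2)[OF 1 2])
  then show "(LINT x:S|lborel. mean_excess y r x)
     = (LINT z:cball y r|lborel. potential 0 S z) - measure lborel (cball y r) * potential 0 S y"
    using potential_symmetric[OF assms, of "cball y r"]
    by (simp add: potential_def[of 0 S y] del: content_cball)
qed

text \<open>Off \<open>y\<close> the kernel with pole \<open>y\<close> is strictly increasing in the distance to \<open>y\<close>, so it cannot be almost
everywhere at least its own average over a ball about \<open>y\<close>: it takes a value below the average at some \<open>z0\<close>, hence at
all points that are nearer to \<open>y\<close>. The potential of the ball is continuous, so near \<open>y\<close> it stays above that value.
Arguing by monotonicity covers the bounded kernel of dimension 1 and the unbounded ones alike.\<close>
lemma mean_excess_pos_near:
  fixes y :: "'a::euclidean_space"
  assumes r: "r > 0"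
  obtains \<delta> where "\<delta> > 0" "\<And>x. x \<in> ball y \<delta> \<Longrightarrow> x \<noteq> y \<Longrightarrow> mean_excess y r x > 0"
proof -
  define T where "T = cball y r"
  define m where "m = measure lborel T"
  have m: "m > 0" unfolding m_def T_def using r by (simp add: content_cball_pos)
  have T: "bounded T" "T \<in> sets borel" by (auto simp: T_def)
  obtain z0 where z0: "z0 \<noteq> y" "m * newton_kernel 0 (z0 - y) < potential 0 T y"
  proof (rule ccontr)
    assume "\<not> thesis"
    then have ge: "potential 0 T y \<le> m * newton_kernel 0 (z - y)" if "z \<noteq> y" for z
      using that \<open>\<And>z0. \<lbrakk>z0 \<noteq> y; m * newton_kernel 0 (z0 - y) < potential 0 T y\<rbrakk> \<Longrightarrow> thesis\<close> by force
    define g where "g z = indicator T z * (m * newton_kernel 0 (z - y) - potential 0 T y)" for z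
    have i1: "set_integrable lborel T (\<lambda>z. m * newton_kernel 0 (z - y))"
      by (intro set_integrable_mult_right newton_kernel_integrable T) auto
    have i2: "set_integrable lborel T (\<lambda>z. potential 0 T y)"
      unfolding set_integrable_def T_def by (intro borel_integrable_compact) auto
    have gi: "integrable lborel g" and "(\<integral>z. g z \<partial>lborel) = 0"
    proof -
      show "integrable lborel g"
        using set_integral_diff(1)[OF i1 i2] by (simp add: g_def[abs_def] set_integrable_def)
      have "(\<integral>z. g z \<partial>lborel) = (LINT z:T|lborel. m * newton_kernel 0 (z - y)) - (LINT z:T|lborel. potential 0 T y)"
        using set_integral_diff(2)[OF i1 i2] by (simp add: g_def[abs_def] set_lebesgue_integral_def)
      also have "(LINT z:T|lborel. m * newton_kernel 0 (z - y)) = m * potential 0 T y"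
        by (simp add: potential_def)
      also have "(LINT z:T|lborel. potential 0 T y) = m * potential 0 T y"
        using T by (simp add: set_lebesgue_integral_def m_def)
      finally show "(\<integral>z. g z \<partial>lborel) = 0" by simp
    qed
    moreover have "AE z in lborel. 0 \<le> g z"
      using AE_lborel_singleton[of y] by eventually_elim (use ge in \<open>auto simp: g_def\<close>)
    ultimately have g0: "AE z in lborel. g z = 0"
      using integral_nonneg_eq_0_iff_AE by blast
    obtain s where s: "\<And>z. z \<noteq> y \<Longrightarrow> m * newton_kernel 0 (z - y) = potential 0 T y \<Longrightarrow> norm (z - y) = s"
    proof (cases "\<exists>z1. z1 \<noteq> y \<and> m * newton_kernel 0 (z1 - y) = potential 0 T y")
      case True
      then obtain z1 where z1: "z1 \<noteq> y" "m * newton_kernel 0 (z1 - y) = potential 0 T y" by blast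
      have "norm (z - y) = norm (z1 - y)" if "z \<noteq> y" "m * newton_kernel 0 (z - y) = potential 0 T y" for z
      proof (rule newton_kernel_eq_imp_norm_eq)
        have "m * newton_kernel 0 (z - y) = m * newton_kernel 0 (z1 - y)" using z1 that by simp
        then show "newton_kernel 0 (z - y) = newton_kernel 0 (z1 - y)" using m by simp
      qed (use z1 that in auto)
      then show ?thesis by (rule that)
    qed (use that in blast)
    \<comment> \<open>the kernel equals the average only on a sphere about \<open>y\<close>, which is null, so the ball would be null\<close>
    have "AE z in lborel. z \<notin> T"
      using g0 AE_lborel_singleton[of y] AE_lborel_not_sphere[of y s]
    proof eventually_elim
      case (elim z)
      then show ?case using s[of z] by (auto simp: g_def dist_norm norm_minus_commute)
    qed
    then have "emeasure lborel T = 0"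
      using T by (subst (asm) AE_iff_measurable[of T]) auto
    then show False using m by (simp add: m_def measure_def)
  qed
  have "isCont (potential 0 T) y"
    using potential_continuous[OF T] by (simp add: continuous_on_eq_continuous_at)
  then have "\<forall>\<^sub>F x in at y. m * newton_kernel 0 (z0 - y) < potential 0 T x"
    using z0(2) by (auto simp: isCont_def dest: order_tendstoD(1))
  then obtain d where d: "d > 0" "\<And>x. x \<noteq> y \<Longrightarrow> dist x y < d \<Longrightarrow> m * newton_kernel 0 (z0 - y) < potential 0 T x"
    by (auto simp: eventually_at)
  show ?thesis
  proof (rule that[of "min d (norm (z0 - y))"])
    show "min d (norm (z0 - y)) > 0" using d z0 by auto
    fix x assume x: "x \<in> ball y (min d (norm (z0 - y)))" "x \<noteq> y"
    then have "newton_kernel 0 (x - y) \<le> newton_kernel 0 (z0 - y)"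
      by (intro newton_kernel_radial_mono) (auto simp: dist_norm norm_minus_commute)
    then have "m * newton_kernel 0 (x - y) \<le> m * newton_kernel 0 (z0 - y)"
      using m by (intro mult_left_mono) auto
    also have "\<dots> < potential 0 T x" using d x by (simp add: dist_commute)
    finally show "mean_excess y r x > 0" by (simp add: mean_excess_def T_def m_def)
  qed
qed

section \<open>The maximum principle\<close>

text \<open>A positive maximum would be attained on a compact subset of \<open>\<Omega>\<close>. At a point of this set that is extremal in some
direction, the mean value inequality forces the maximum to be attained on a whole ball, and hence farther out.\<close>
lemma nonpos_of_sub_mean_value:
  fixes v :: "'a::euclidean_space \<Rightarrow> real"
  assumes cont: "continuous_on UNIV v" and bdd: "bounded \<Omega>"
    and off: "\<And>x. x \<notin> \<Omega> \<Longrightarrow> v x \<le> 0"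
    and mean: "\<And>y. y \<in> \<Omega> \<Longrightarrow> \<exists>r>0. measure lborel (cball y r) * v y \<le> (LINT z:cball y r|lborel. v z)"
  shows "v x \<le> 0"
proof (rule ccontr)
  assume "\<not> v x \<le> 0"
  then have vx: "v x > 0" "x \<in> closure \<Omega>" using off[of x] closure_subset by (auto intro: ccontr)
  have comp: "compact (closure \<Omega>)" using bdd by simp
  have c: "continuous_on A v" for A using cont by (rule continuous_on_subset) simp
  obtain m where m: "m \<in> closure \<Omega>" "\<And>z. z \<in> closure \<Omega> \<Longrightarrow> v z \<le> v m"
    using continuous_attains_sup[OF comp _ c] vx(2) by (metis empty_iff)
  define M where "M = v m"
  have M0: "M > 0" using m(2)[OF vx(2)] vx by (simp add: M_def)
  have le: "v z \<le> M" for z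
  proof (cases "z \<in> \<Omega>")
    case True
    then show ?thesis using m(2)[of z] closure_subset by (auto simp: M_def)
  qed (use off[of z] M0 in simp)
  define Z where "Z = {z \<in> closure \<Omega>. v z = M}"
  have "closed (v -` {M})"
    using cont by (auto simp: continuous_on_closed_vimage)
  then have "compact (closure \<Omega> \<inter> v -` {M})" using comp by (rule compact_Int_closed[rotated])
  moreover have "Z = closure \<Omega> \<inter> v -` {M}" by (auto simp: Z_def)
  ultimately have compZ: "compact Z" by simp
  have neZ: "Z \<noteq> {}" using m by (auto simp: Z_def M_def)
  obtain b :: 'a where b: "b \<in> Basis" using nonempty_Basis by blast
  have cb: "continuous_on Z (\<lambda>z. z \<bullet> b)" by (intro continuous_intros)
  obtain y where y: "y \<in> Z" "\<And>z. z \<in> Z \<Longrightarrow> z \<bullet> b \<le> y \<bullet> b"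
    using continuous_attains_sup[OF compZ neZ cb] by blast
  have vy: "v y = M" using y by (simp add: Z_def)
  have "y \<in> \<Omega>" using off[of y] vy M0 by (auto intro: ccontr)
  from mean[OF this] obtain r where r: "r > 0"
    and mv: "measure lborel (cball y r) * M \<le> (LINT z:cball y r|lborel. v z)"
    unfolding vy by blast
  define q where "q = y + (r / 2) *\<^sub>R b"
  have "v q \<noteq> M"
  proof
    assume q: "v q = M"
    then have "q \<in> \<Omega>" using off[of q] M0 by (auto intro: ccontr)
    then have "q \<in> Z" using q closure_subset by (auto simp: Z_def)
    from y(2)[OF this] show False using r b by (simp add: q_def inner_add_left)
  qed
  then have vq: "v q < (M + v q) / 2" "(M + v q) / 2 < M" using le[of q] by auto
  have "isCont v q" using cont by (simp add: continuous_on_eq_continuous_at)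
  then have "\<forall>\<^sub>F z in at q. v z < (M + v q) / 2"
    unfolding isCont_def using vq(1) by (rule order_tendstoD(2))
  then obtain d where d: "d > 0" "\<And>z. z \<noteq> q \<Longrightarrow> dist z q < d \<Longrightarrow> v z < (M + v q) / 2"
    unfolding eventually_at by blast
  define \<rho> where "\<rho> = min d (r / 2)"
  have \<rho>: "\<rho> > 0" "\<rho> \<le> d" "\<rho> \<le> r / 2" using d r by (auto simp: \<rho>_def)
  have sub: "ball q \<rho> \<subseteq> cball y r"
  proof
    fix z assume "z \<in> ball q \<rho>"
    moreover have "dist y q = r / 2" using b r by (simp add: q_def dist_norm)
    ultimately show "z \<in> cball y r" using dist_triangle[of y z q] \<rho> by simp
  qed
  define \<epsilon> where "\<epsilon> = M - (M + v q) / 2"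
  have \<epsilon>: "\<epsilon> > 0" using vq by (simp add: \<epsilon>_def)
  have i1: "set_integrable lborel (cball y r) v" and i2: "set_integrable lborel (cball y r) (\<lambda>z. M)"
    unfolding set_integrable_def by (intro borel_integrable_compact compact_cball c continuous_on_const)+
  have "0 < \<epsilon> * measure lborel (ball q \<rho>)"
    using \<epsilon> content_ball_pos[OF \<rho>(1), of q] by simp
  also have "\<dots> = (\<integral>z. indicator (ball q \<rho>) z * \<epsilon> \<partial>lborel)" by simp
  also have "\<dots> \<le> (LINT z:cball y r|lborel. M - v z)"
    unfolding set_lebesgue_integral_def
  proof (rule integral_mono)
    show "integrable lborel (\<lambda>z. indicator (ball q \<rho>) z * \<epsilon>)"
      using emeasure_bounded_finite[of "ball q \<rho>"] by (auto simp: integrable_indicator_iff)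
    show "integrable lborel (\<lambda>z. indicator (cball y r) z *\<^sub>R (M - v z))"
      using set_integral_diff(1)[OF i2 i1] by (simp add: set_integrable_def)
    fix z :: 'a
    show "indicator (ball q \<rho>) z * \<epsilon> \<le> indicator (cball y r) z *\<^sub>R (M - v z)"
    proof (cases "z \<in> ball q \<rho>")
      case True
      then have "v z < (M + v q) / 2" using d(2)[of z] vq(1) \<rho> by (cases "z = q") (auto simp: dist_commute)
      then show ?thesis using True sub by (auto simp: \<epsilon>_def)
    qed (use le[of z] in \<open>auto simp: indicator_def\<close>)
  qed
  also have "\<dots> = measure lborel (cball y r) * M - (LINT z:cball y r|lborel. v z)"
    using set_integral_diff(2)[OF i2 i1] by (simp add: set_lebesgue_integral_def)
  finally show False using mv by linarith
qed

section \<open>Kernels as test functions on quadrature domains\<close>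

lemma lebesgue_on_integral_lborel:
  fixes g :: "'a::euclidean_space \<Rightarrow> real"
  assumes "S \<in> sets borel" "set_integrable lborel S g"
  shows "integrable (lebesgue_on S) g" and "integral\<^sup>L (lebesgue_on S) g = (LINT x:S|lborel. g x)"
proof -
  have m: "(\<lambda>x. indicator S x *\<^sub>R g x) \<in> borel_measurable lborel"
    using assms(2) unfolding set_integrable_def by (rule borel_measurable_integrable)
  have S: "S \<inter> space lebesgue \<in> sets lebesgue" using assms(1) by simp
  show "integrable (lebesgue_on S) g"
    using assms(2) unfolding integrable_restrict_space[OF S] integrable_completion[OF m] set_integrable_def .
  show "integral\<^sup>L (lebesgue_on S) g = (LINT x:S|lborel. g x)"
    unfolding integral_restrict_space[OF S] integral_completion[OF m] set_lebesgue_integral_def ..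
qed

lemma ereal_integrable_on_real:
  fixes g :: "'a::euclidean_space \<Rightarrow> real"
  assumes "S \<in> sets borel" "set_integrable lborel S g"
  shows "(\<lambda>x. ereal (g x)) ereal_integrable_on S"
  using lebesgue_on_integral_lborel(1)[OF assms]
  unfolding ereal_integrable_on_def integrable_iff_bounded
  by (auto simp: e2ennreal_ereal)

text \<open>The averages in the definition of subharmonicity run over open balls, the mean value inequalities above over closed ones;
spheres are null, so the two agree.\<close>
lemma subharmonic_on_continuous:
  fixes g :: "'a::euclidean_space \<Rightarrow> real"
  assumes \<Omega>: "open \<Omega>" and g: "continuous_on \<Omega> g"
    and mean: "\<And>x r. r > 0 \<Longrightarrow> cball x r \<subseteq> \<Omega> \<Longrightarrow> measure lborel (cball x r) * g x \<le> (LINT z:cball x r|lborel. g z)"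
  shows "subharmonic_on \<Omega> (\<lambda>x. ereal (g x))"
  unfolding subharmonic_on_def ereal_locally_integrable_on_def
proof (intro conjI allI impI ballI \<Omega>)
  fix K assume "compact K \<and> K \<subseteq> \<Omega>"
  then have K: "compact K" "continuous_on K g" using g by (auto intro: continuous_on_subset)
  show "(\<lambda>x. ereal (g x)) ereal_integrable_on K"
  proof (rule ereal_integrable_on_real)
    show "K \<in> sets borel" using K by (simp add: borel_compact)
    show "set_integrable lborel K g"
      unfolding set_integrable_def using K by (rule borel_integrable_compact)
  qed
next
  fix x assume x: "x \<in> \<Omega>"
  show "subharmonic_at \<Omega> (\<lambda>x. ereal (g x)) x"
    unfolding subharmonic_at_def
  proof
    have "at x within \<Omega> = at x" using x \<Omega> by (rule at_within_open)
    then have "at x within \<Omega> \<noteq> bot" by simp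
    moreover have "((\<lambda>x. ereal (g x)) \<longlongrightarrow> ereal (g x)) (at x within \<Omega>)"
      using g x by (intro tendsto_ereal) (simp add: continuous_on_def)
    ultimately have "Limsup (at x within \<Omega>) (\<lambda>x. ereal (g x)) = ereal (g x)"
      by (rule lim_imp_Limsup)
    then show "Limsup (at x within \<Omega>) (\<lambda>x. ereal (g x)) \<le> ereal (g x)"
      by (rule eq_refl)
    obtain \<rho> where \<rho>: "\<rho> > 0" "cball x \<rho> \<subseteq> \<Omega>"
      using \<Omega> x open_contains_cball by blast
    have "ereal (g x) \<le> ereal (ball_average (\<lambda>x. ereal (g x)) x r)" if r: "0 < r" "r < \<rho>" for r
    proof -
      have rs: "cball x r \<subseteq> \<Omega>" using r \<rho> by force
      have si: "set_integrable lborel (cball x r) g"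
        unfolding set_integrable_def
        using g rs by (intro borel_integrable_compact compact_cball) (rule continuous_on_subset)
      have si': "set_integrable lborel (ball x r) g"
        by (rule set_integrable_subset[OF si]) auto
      have m: "measure lebesgue (ball x r) = measure lborel (cball x r)"
        using r by (simp add: content_ball content_cball)
      have "(LINT z:cball x r|lborel. g z) = (LINT z:ball x r|lborel. g z)"
        unfolding set_lebesgue_integral_def
      proof (rule integral_cong_AE)
        show "AE z in lborel. indicator (cball x r) z *\<^sub>R g z = indicator (ball x r) z *\<^sub>R g z"
          using AE_lborel_not_sphere[of x r] by eventually_elim (auto simp: indicator_def)
      qed (use si si' in \<open>auto simp: set_integrable_def\<close>)
      also have "\<dots> = ereal_integral (ball x r) (\<lambda>x. ereal (g x))"
        using lebesgue_on_integral_lborel(2)[OF _ si'] by (simp add: ereal_integral_def)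
      finally have "measure lborel (cball x r) * g x \<le> ereal_integral (ball x r) (\<lambda>x. ereal (g x))"
        using mean[OF r(1) rs] by simp
      moreover have "measure lborel (cball x r) > 0"
        using r by (simp add: content_cball_pos)
      ultimately show ?thesis
        unfolding ball_average_def m by (simp add: pos_le_divide_eq mult.commute del: content_cball)
    qed
    then show "\<forall>\<^sub>F r in at_right 0. ereal (g x) \<le> ereal (ball_average (\<lambda>x. ereal (g x)) x r)"
      using \<rho>(1) by (auto simp: eventually_at_right_field)
  qed
qed

text \<open>The weight vanishes off \<open>\<Omega>\<close>, so its integral extends to the whole space. This makes the left-hand sides for two
different quadrature domains comparable.\<close>
lemma quadrature_domain_real_test:
  fixes g w :: "'a::euclidean_space \<Rightarrow> real"
  assumes q: "quadrature_domain w \<Omega>" and g: "continuous_on \<Omega> g" "set_integrable lborel \<Omega> g"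
    and mean: "\<And>x r. r > 0 \<Longrightarrow> cball x r \<subseteq> \<Omega> \<Longrightarrow> measure lborel (cball x r) * g x \<le> (LINT z:cball x r|lborel. g z)"
  shows "(\<integral>x. g x * w x \<partial>lebesgue) \<le> (LINT x:\<Omega>|lborel. g x)"
proof -
  have o: "open \<Omega>" and off: "\<And>x. x \<notin> \<Omega> \<Longrightarrow> w x = 0"
    using q by (auto simp: quadrature_domain_def)
  have S: "\<Omega> \<in> sets borel" "\<Omega> \<inter> space lebesgue \<in> sets lebesgue" using o by auto
  have "ereal_integral \<Omega> (\<lambda>x. ereal (g x) * ereal (w x)) \<le> ereal_integral \<Omega> (\<lambda>x. ereal (g x))"
    using q ereal_integrable_on_real[OF S(1) g(2)] subharmonic_on_continuous[OF o g(1) mean]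
    unfolding quadrature_domain_def by blast
  moreover have "ereal_integral \<Omega> (\<lambda>x. ereal (g x)) = (LINT x:\<Omega>|lborel. g x)"
    using lebesgue_on_integral_lborel(2)[OF S(1) g(2)] by (simp add: ereal_integral_def)
  moreover have "ereal_integral \<Omega> (\<lambda>x. ereal (g x) * ereal (w x)) = (\<integral>x. g x * w x \<partial>lebesgue)"
    unfolding ereal_integral_def integral_restrict_space[OF S(2)]
    by (intro Bochner_Integration.integral_cong) (auto simp: indicator_def off)
  ultimately show ?thesis by simp
qed

text \<open>Both inequalities pass through the potential of the weight: off \<open>\<Omega>\<close> the kernel is harmonic on \<open>\<Omega>\<close>, and the
regularized kernels, which are real-valued and subharmonic on \<open>\<Omega>'\<close>, lie above it. The limit \<open>e \<rightarrow> 0\<close> is taken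
only in the potential of \<open>\<Omega>'\<close>.\<close>
lemma quadrature_potential_le:
  fixes w :: "'a::euclidean_space \<Rightarrow> real"
  assumes w: "weight_function w" and q: "quadrature_domain w \<Omega>" and q': "quadrature_domain w \<Omega>'"
    and y: "y \<notin> \<Omega>"
  shows "potential 0 \<Omega> y \<le> potential 0 \<Omega>' y"
proof -
  have O: "open \<Omega>" "bounded \<Omega>" "\<Omega> \<in> sets borel" and off: "\<And>x. x \<notin> \<Omega> \<Longrightarrow> w x = 0"
    using q by (auto simp: quadrature_domain_def)
  have O': "open \<Omega>'" "bounded \<Omega>'" "\<Omega>' \<in> sets borel"
    using q' by (auto simp: quadrature_domain_def)
  have wm: "w \<in> borel_measurable lebesgue" and w0: "\<And>x. 0 \<le> w x"
    using w by (auto simp: weight_function_def)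
  obtain C where C: "\<And>x. \<bar>w x\<bar> \<le> C"
    using w unfolding weight_function_def bounded_iff by force
  let ?k = "\<lambda>e x. newton_kernel e (x - y)"
  have kw: "integrable lebesgue (\<lambda>x. ?k e x * w x)" if "e \<ge> 0" for e
  proof (rule Bochner_Integration.integrable_bound)
    have "integrable lborel (\<lambda>x. indicator \<Omega> x *\<^sub>R ?k e x)"
      using newton_kernel_integrable[OF that O(2,3), of y] by (simp add: set_integrable_def)
    then have "integrable lebesgue (\<lambda>x. indicator \<Omega> x *\<^sub>R ?k e x)"
      by (simp add: integrable_completion borel_measurable_integrable)
    then show "integrable lebesgue (\<lambda>x. C * (indicator \<Omega> x *\<^sub>R ?k e x))" by simp
    have "?k e \<in> borel_measurable lebesgue"
      by (rule measurable_completion) measurable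
    then show "(\<lambda>x. ?k e x * w x) \<in> borel_measurable lebesgue"
      using wm by (rule borel_measurable_times)
    have "norm (?k e x * w x) \<le> norm (C * (indicator \<Omega> x *\<^sub>R ?k e x))" for x
    proof (cases "x \<in> \<Omega>")
      case True
      have "\<bar>w x\<bar> \<le> \<bar>C\<bar>" using C[of x] by linarith
      then have "\<bar>?k e x\<bar> * \<bar>w x\<bar> \<le> \<bar>?k e x\<bar> * \<bar>C\<bar>" by (rule mult_left_mono) simp
      then show ?thesis using True by (simp add: abs_mult mult.commute)
    qed (simp add: off)
    then show "AE x in lebesgue. norm (?k e x * w x) \<le> norm (C * (indicator \<Omega> x *\<^sub>R ?k e x))"
      by simp
  qed
  have c: "continuous_on A (?k e)" if "e > 0 \<or> e = 0 \<and> y \<notin> A" for e A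
  proof -
    have "continuous_on ((\<lambda>x. x - y) ` A) (newton_kernel e)"
      using that by (intro newton_kernel_continuous_on) (auto intro: add_nonneg_pos)
    then show ?thesis
      by (rule continuous_on_compose2) (auto intro: continuous_intros)
  qed
  have "(\<integral>x. - ?k 0 x * w x \<partial>lebesgue) \<le> (LINT x:\<Omega>|lborel. - ?k 0 x)"
  proof (rule quadrature_domain_real_test[OF q])
    show "continuous_on \<Omega> (\<lambda>x. - ?k 0 x)" using y by (intro continuous_on_minus c) simp
    show "set_integrable lborel \<Omega> (\<lambda>x. - ?k 0 x)"
      using newton_kernel_integrable[OF _ O(2,3), of 0 y] by (simp add: set_integrable_def)
    fix x r assume "(0::real) < r" "cball x r \<subseteq> \<Omega>"
    then have "(LINT z:cball x r|lborel. ?k 0 z) = measure lborel (cball x r) * ?k 0 x"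
      using y by (intro newton_kernel_mean_value(2)) auto
    then show "measure lborel (cball x r) * - ?k 0 x \<le> (LINT z:cball x r|lborel. - ?k 0 z)"
      by (simp add: set_lebesgue_integral_def)
  qed
  then have 1: "potential 0 \<Omega> y \<le> (\<integral>x. ?k 0 x * w x \<partial>lebesgue)"
    by (simp add: potential_def set_lebesgue_integral_def)
  have 2: "(\<integral>x. ?k 0 x * w x \<partial>lebesgue) \<le> (\<integral>x. ?k e x * w x \<partial>lebesgue)" if e: "e > 0" for e
  proof (rule integral_mono)
    fix x
    show "?k 0 x * w x \<le> ?k e x * w x"
    proof (cases "x = y")
      case False
      then show ?thesis using e w0 by (intro mult_right_mono newton_kernel_mono) auto
    qed (use off y in simp)
  qed (use kw e in auto)
  have 3: "(\<integral>x. ?k e x * w x \<partial>lebesgue) \<le> potential e \<Omega>' y" if e: "e > 0" for e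
    unfolding potential_def
  proof (rule quadrature_domain_real_test[OF q'])
    show "continuous_on \<Omega>' (?k e)" using e by (intro c) simp
    show "set_integrable lborel \<Omega>' (?k e)"
      using newton_kernel_integrable[OF _ O'(2,3)] e by simp
    fix x r assume "(0::real) < r"
    then show "measure lborel (cball x r) * ?k e x \<le> (LINT z:cball x r|lborel. ?k e z)"
      using e by (intro newton_kernel_mean_value(1)) auto
  qed
  have "potential 0 \<Omega> y \<le> potential (1 / Suc n) \<Omega>' y" for n
    using 1 2[of "1 / Suc n"] 3[of "1 / Suc n"] by fastforce
  then show ?thesis
    by (intro LIMSEQ_le_const[OF potential_tendsto[OF O'(2,3)]]) blast
qed

section \<open>Uniqueness of quadrature domains\<close>

text \<open>The averaged form of the statement that the Laplacian of \<open>v\<close> on \<open>\<Omega>\<close> is a multiple of the indicator of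
\<open>\<Omega> - \<Omega>'\<close>. Poles off \<open>\<Omega>\<close> lie outside the ball, where \<open>mean_excess\<close> vanishes, so the part of \<open>\<Omega>'\<close>
that could contribute negatively is invisible.\<close>
lemma potential_difference_mean_value:
  fixes \<Omega> \<Omega>' :: "'a::euclidean_space set"
  assumes O: "bounded \<Omega>" "\<Omega> \<in> sets borel" and O': "bounded \<Omega>'" "\<Omega>' \<in> sets borel"
    and r: "r > 0" "cball y r \<subseteq> \<Omega>"
  defines "v \<equiv> \<lambda>x. potential 0 \<Omega> x - potential 0 \<Omega>' x"
  shows "(LINT z:cball y r|lborel. v z) - measure lborel (cball y r) * v y = (LINT x:\<Omega> - \<Omega>'|lborel. mean_excess y r x)"
proof -
  note J = mean_excess_integral[OF O, of y r] and J' = mean_excess_integral[OF O', of y r]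
  have "set_integrable lborel (cball y r) (potential 0 S)" if "bounded S" "S \<in> sets borel" for S
    unfolding set_integrable_def
    by (intro borel_integrable_compact compact_cball continuous_on_subset[OF potential_continuous[OF that]]) auto
  then have "(LINT z:cball y r|lborel. v z) = (LINT z:cball y r|lborel. potential 0 \<Omega> z) - (LINT z:cball y r|lborel. potential 0 \<Omega>' z)"
    unfolding v_def using O O' by (intro set_integral_diff) auto
  then have "(LINT z:cball y r|lborel. v z) - measure lborel (cball y r) * v y
      = (LINT x:\<Omega>|lborel. mean_excess y r x) - (LINT x:\<Omega>'|lborel. mean_excess y r x)"
    unfolding J(2) J'(2) v_def right_diff_distrib by linarith
  also have "\<dots> = (\<integral>x. indicator \<Omega> x *\<^sub>R mean_excess y r x - indicator \<Omega>' x *\<^sub>R mean_excess y r x \<partial>lborel)"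
    unfolding set_lebesgue_integral_def
    using J(1) J'(1) by (intro Bochner_Integration.integral_diff[symmetric]) (auto simp: set_integrable_def)
  also have "\<dots> = (LINT x:\<Omega> - \<Omega>'|lborel. mean_excess y r x)"
    unfolding set_lebesgue_integral_def
  proof (intro Bochner_Integration.integral_cong refl)
    fix x
    have "x \<in> \<Omega> \<or> mean_excess y r x = 0"
      using mean_excess_outside[OF r(1)] r(2) by blast
    then show "indicator \<Omega> x *\<^sub>R mean_excess y r x - indicator \<Omega>' x *\<^sub>R mean_excess y r x
        = indicator (\<Omega> - \<Omega>') x *\<^sub>R mean_excess y r x"
      by (auto simp: indicator_def)
  qed
  finally show ?thesis .
qed

lemma mean_excess_integral_nonneg:
  assumes "r > 0"
  shows "(LINT x:S|lborel. mean_excess y r x) \<ge> 0"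
  unfolding set_lebesgue_integral_def
proof (rule integral_nonneg_AE)
  show "AE x in lborel. 0 \<le> indicator S x *\<^sub>R mean_excess y r x"
    using AE_lborel_singleton[of y] by eventually_elim (use mean_excess_nonneg[OF assms, of _ y] in \<open>simp add: indicator_def\<close>)
qed

lemma quadrature_potential_le_everywhere:
  fixes w :: "'a::euclidean_space \<Rightarrow> real"
  assumes w: "weight_function w" and q: "quadrature_domain w \<Omega>" and q': "quadrature_domain w \<Omega>'"
  shows "potential 0 \<Omega> x \<le> potential 0 \<Omega>' x"
proof -
  have O: "open \<Omega>" "bounded \<Omega>" "\<Omega> \<in> sets borel"
    using q by (auto simp: quadrature_domain_def)
  have O': "bounded \<Omega>'" "\<Omega>' \<in> sets borel"
    using q' by (auto simp: quadrature_domain_def)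
  have "potential 0 \<Omega> x - potential 0 \<Omega>' x \<le> 0"
  proof (rule nonpos_of_sub_mean_value[OF _ O(2)])
    show "continuous_on UNIV (\<lambda>x. potential 0 \<Omega> x - potential 0 \<Omega>' x)"
      using O O' by (intro continuous_on_diff potential_continuous)
    show "potential 0 \<Omega> y - potential 0 \<Omega>' y \<le> 0" if "y \<notin> \<Omega>" for y
      using quadrature_potential_le[OF w q q' that] by simp
    fix y assume "y \<in> \<Omega>"
    then obtain r where "r > 0" "cball y r \<subseteq> \<Omega>" using O open_contains_cball by blast
    then show "\<exists>r>0. measure lborel (cball y r) * (potential 0 \<Omega> y - potential 0 \<Omega>' y)
        \<le> (LINT z:cball y r|lborel. potential 0 \<Omega> z - potential 0 \<Omega>' z)"
      using potential_difference_mean_value[OF O(2,3) O', of r y] mean_excess_integral_nonneg[of r "\<Omega> - \<Omega>'" y]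
      by (intro exI[of _ r]) linarith
  qed
  then show ?thesis by simp
qed

text \<open>With equal potentials the left-hand side of the mean value identity is zero, so \<open>mean_excess\<close>, which is nonnegative and
positive near the centre of the ball, vanishes almost everywhere on \<open>\<Omega> - \<Omega>'\<close>. Hence every point of this set has a
null neighbourhood in it.\<close>
lemma negligible_diff_of_potential_eq:
  fixes \<Omega> \<Omega>' :: "'a::euclidean_space set"
  assumes O: "open \<Omega>" "bounded \<Omega>" and O': "bounded \<Omega>'" "\<Omega>' \<in> sets borel"
    and eq: "\<And>x. potential 0 \<Omega> x = potential 0 \<Omega>' x"
  shows "negligible (\<Omega> - \<Omega>')"
proof -
  have Ob: "\<Omega> \<in> sets borel" using O by simp
  have "\<exists>U. openin (top_of_set (\<Omega> - \<Omega>')) U \<and> y \<in> U \<and> negligible U" if y: "y \<in> \<Omega> - \<Omega>'" for y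
  proof -
    obtain r where r: "r > 0" "cball y r \<subseteq> \<Omega>" using O y open_contains_cball by blast
    obtain \<delta> where \<delta>: "\<delta> > 0" "\<And>x. x \<in> ball y \<delta> \<Longrightarrow> x \<noteq> y \<Longrightarrow> mean_excess y r x > 0"
      using mean_excess_pos_near[OF r(1), of y] by metis
    define J where "J x = indicator (\<Omega> - \<Omega>') x *\<^sub>R mean_excess y r x" for x
    have int: "integrable lborel J"
      using mean_excess_integral(1)[of "\<Omega> - \<Omega>'" y r] O Ob O' by (auto simp: set_integrable_def J_def[abs_def] bounded_diff)
    have "(\<integral>x. J x \<partial>lborel) = 0"
      using potential_difference_mean_value[OF O(2) Ob O' r]
      by (simp add: eq set_lebesgue_integral_def J_def)
    moreover have "AE x in lborel. 0 \<le> J x"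
      using AE_lborel_singleton[of y] by eventually_elim (use mean_excess_nonneg[OF r(1), of _ y] in \<open>simp add: J_def indicator_def\<close>)
    ultimately have "AE x in lborel. J x = 0"
      using int integral_nonneg_eq_0_iff_AE by blast
    then have "AE x in lborel. x \<notin> (\<Omega> - \<Omega>') \<inter> ball y \<delta>"
      using AE_lborel_singleton[of y] by eventually_elim (use \<delta>(2) in \<open>force simp: J_def\<close>)
    then have "(\<Omega> - \<Omega>') \<inter> ball y \<delta> \<in> null_sets lborel"
      using Ob O' by (subst AE_iff_null_sets) auto
    then have "negligible ((\<Omega> - \<Omega>') \<inter> ball y \<delta>)"
      unfolding negligible_iff_null_sets by (simp add: null_sets_completionI)
    then show ?thesis
      using y \<delta>(1) by (intro exI[of _ "(\<Omega> - \<Omega>') \<inter> ball y \<delta>"]) (auto intro: openin_open_Int)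
  qed
  then show ?thesis by (intro iffD2[OF locally_negligible_alt] ballI)
qed

theorem corollary2p5:
  fixes w :: "real ^ 'd \<Rightarrow> real" and \<Omega> \<Omega>' :: "(real ^ 'd) set"
  assumes "weight_function w"
    and "quadrature_domain w \<Omega>" and "quadrature_domain w \<Omega>'"
  shows "emeasure lebesgue ((\<Omega> - \<Omega>') \<union> (\<Omega>' - \<Omega>)) = 0"
proof -
  have eq: "potential 0 \<Omega> x = potential 0 \<Omega>' x" for x
    using assms quadrature_potential_le_everywhere by (metis order_antisym)
  have "negligible (\<Omega> - \<Omega>')" "negligible (\<Omega>' - \<Omega>)"
    using assms(2,3) eq by (auto simp: quadrature_domain_def intro!: negligible_diff_of_potential_eq)
  then have "negligible ((\<Omega> - \<Omega>') \<union> (\<Omega>' - \<Omega>))" by (rule negligible_Un)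
  then show ?thesis unfolding negligible_iff_null_sets by (rule null_setsD1)
qed

end
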